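(* Let $s_{h,\tau}$ be the nodal stabilization form $$s_{h,\tau}(v,w)=\sum_{i\in I^S}\tau h^{d-2}\varphi_{i,T_i}^*([v]_{T_i,S_h(T_i)})\,\varphi_{i,T_i}^*([w]_{T_i,S_h(T_i)}),$$ and for $\tau\ge\tau_0$ let $u_h=u_{h,\tau}\in V_h$ be the solution of $A_h(u_h,v)=l_h(v)$ for all $v\in V_h$ (forms and parameters as in the context). Then, for fixed $h$, $$\lim_{\tau\to\infty}u_h=\widetilde\Pi_hu_h,$$ in the sense that $u_{h,\tau}-\widetilde\Pi_hu_{h,\tau}\to0$ in $V_h$ as $\tau\to\infty$.
   Context: Mesh and spaces. $\mathcal T_{h,0}$, $h\in(0,h_0]$, is a family of quasiuniform (in particular shape regular) meshes of closed simplices with mesh parameter $h$ on a closed polygonal domain $\Omega_0\subset\mathbb R^d$, and $V_{h,0}=\{v\in C^0(\Omega_0): v|_T\in\mathbb P_k(T)\ \forall T\in\mathcal T_{h,0}\}$, where $\mathbb P_k$ denotes polynomials of degree at most $k$, $k\ge1$. $\Omega\subset\Omega_0$ is a given closed domain, $\mathcal T_h=\{T\in\mathcal T_{h,0}:T\cap\Omega\ne\emptyset\}$, $\Omega_h=\bigcup_{T\in\mathcal T_h}T$, and $V_h=V_{h,0}|_{\Omega_h}$. $(\cdot,\cdot)_X$ and $\|\cdot\|_X$ are the $L^2(X)$ inner product and norm; $\nabla_n=n\cdot\nabla$ with $n$ the outward unit normal to $\partial\Omega$. $\{\varphi_i\}_{i\in I}$ is the standard (nodal) finite element basis of $V_h$,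 and for $T\in\mathcal T_h$ with $T\subset\mathrm{supp}(\varphi_i)$, $\varphi_{i,T}^*$ are the element degrees of freedom (dual to the element basis); $\varphi_{i,T}^*(p)$ for $p\in\mathbb P_k(\mathbb R^d)$ means $\varphi_{i,T}^*(p|_T)$. For a polynomial $p$ on an element, $p^e\in\mathbb P_k(\mathbb R^d)$ is its canonical extension, and $[v]_{T_1,T_2}=(v|_{T_1})^e-(v|_{T_2})^e$ for $v\in V_h$. Large and small elements. For a fixed $\gamma\in(0,1]$, $\mathcal T_h^L=\{T\in\mathcal T_h:|T\cap\Omega|\ge\gamma|T|\}$ and $\mathcal T_h^S=\mathcal T_h\setminus\mathcal T_h^L$. $S_h:\mathcal T_h^S\to\mathcal T_h^L$ is a given map. $I^S\subset I$ is the set of indices $i$ such that $\mathrm{supp}(\varphi_i)$ contains no element of $\mathcal T_h^L$, and $I^L=I\setminus I^S$. For $i\in I^S$, $T_i\subset\mathrm{supp}(\varphi_i)$ is a chosen element (necessarily in $\mathcal T_h^S$); for $i\in I^L$, $T_i\in\mathcal T_h^L$ is a chosen large element in $\mathrm{supp}(\varphi_i)$. The operator $\widetilde\Pi_h:V_h\to V_h$ is $$\widetilde\Pi_hv=\sum_{i\in I^S}\varphi_{i,T_i}^*\big((v|_{S_h(T_i)})^e\big)\varphi_i+\sum_{i\in I^L}\varphi_{i,T_i}^*(v)\varphi_i.$$ Method. For $f\in L^2(\Omega)$, $A_h(v,w)=a_h(v,w)+s_{h,\tau}(v,w)$ with $$a_h(v,w)=(\nabla v,\nabla w)_\Omega-(\nabla_nv,w)_{\partial\Omega}-(v,\nabla_nw)_{\partial\Omega}+\beta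 h^{-1}(v,w)_{\partial\Omega},\qquad l_h(v)=(f,v)_\Omega.$$ Standing assumptions: for some fixed $\tau_*>0$ and a constant $C_I$ independent of $h$, $h\|\nabla_nv\|_{\partial\Omega}^2\le C_I(\|\nabla v\|_\Omega^2+s_{h,\tau_*}(v,v))$ for all $v\in V_h$; $\beta\ge\beta_0$ with $\beta_0$ sufficiently large, and $\tau\ge\tau_0$ with $\tau_0\ge c_0\beta^{-1}$, $c_0$ sufficiently large (depending only on $C_I,\tau_*$). *)

theory Defs
  imports "HOL-Analysis.Analysis"
begin

section \<open>Surface measure and outward normal\<close>

text \<open>
  Hausdorff measure of dimension \<open>s\<close>, normalised so that it agrees with Lebesgue measure on flat
  \<open>s\<close>-dimensional pieces. The empty set is singled out because \<open>0 ^ 0 = 1\<close>; the boundedness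
  condition is needed because \<^const>\<open>diameter\<close> is meaningless on unbounded sets.
\<close>

definition hausdorff_pre :: "nat \<Rightarrow> real \<Rightarrow> 'a::metric_space set \<Rightarrow> ennreal" where
  "hausdorff_pre s \<delta> A =
     (INF U \<in> {U :: nat \<Rightarrow> 'a set. A \<subseteq> (\<Union>i. U i) \<and> (\<forall>i. bounded (U i) \<and> diameter (U i) \<le> \<delta>)}.
        \<Sum>i. if U i = {} then 0 else ennreal (unit_ball_vol (real s) * (diameter (U i) / 2) ^ s))"

definition hausdorff_outer :: "nat \<Rightarrow> 'a::metric_space set \<Rightarrow> ennreal" where
  "hausdorff_outer s A = (SUP \<delta> \<in> {0<..}. hausdorff_pre s \<delta> A)"

definition surface_measure :: "(real ^ 'n) measure" where
  "surface_measure =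
     completion (measure_of UNIV (sets borel) (hausdorff_outer (CARD('n) - 1)))"

definition closed_domain :: "'a::topological_space set \<Rightarrow> bool" where
  "closed_domain S \<longleftrightarrow> S \<noteq> {} \<and> connected (interior S) \<and> closure (interior S) = S"

text \<open>
  \<open>\<nu>\<close> is the outward unit normal to \<open>\<Omega>\<close> at the boundary point \<open>x\<close> if near \<open>x\<close> the set \<open>\<Omega>\<close> is, up to
  cones of arbitrarily small aperture around the tangent hyperplane, the half space
  \<open>(y - x) \<bullet> \<nu> \<le> 0\<close>. This is the usual normal wherever the boundary is differentiable, and it
  determines \<open>\<nu>\<close> uniquely.
\<close>

definition outward_unit_normal :: "'a::real_inner set \<Rightarrow> 'a \<Rightarrow> 'a \<Rightarrow> bool" where
  "outward_unit_normal \<Omega> x \<nu> \<longleftrightarrow> norm \<nu> = 1 \<and>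
     (\<forall>\<epsilon>>0. \<exists>r>0. \<forall>y \<in> ball x r.
        ((y - x) \<bullet> \<nu> < - \<epsilon> * norm (y - x) \<longrightarrow> y \<in> \<Omega>) \<and>
        ((y - x) \<bullet> \<nu> > \<epsilon> * norm (y - x) \<longrightarrow> y \<notin> \<Omega>))"

text \<open>
  The boundary regularity that gives the boundary integrals a meaning: finite surface measure and a
  measurable outward unit normal almost everywhere (in particular Lipschitz boundaries qualify).
\<close>

definition regular_boundary :: "(real ^ 'n) set \<Rightarrow> (real ^ 'n \<Rightarrow> real ^ 'n) \<Rightarrow> bool" where
  "regular_boundary \<Omega> n \<longleftrightarrow>
     emeasure surface_measure (frontier \<Omega>) < \<infinity> \<and>
     set_borel_measurable surface_measure (frontier \<Omega>) n \<and>
     (AE x in surface_measure. x \<in> frontier \<Omega> \<longrightarrow> outward_unit_normal \<Omega> x (n x))"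

section \<open>L2 products and differential operators\<close>

definition l2_inner :: "'a measure \<Rightarrow> 'a set \<Rightarrow> ('a \<Rightarrow> 'b::real_inner) \<Rightarrow> ('a \<Rightarrow> 'b) \<Rightarrow> real" where
  "l2_inner M X v w = (LINT x:X|M. v x \<bullet> w x)"

definition l2_norm :: "'a measure \<Rightarrow> 'a set \<Rightarrow> ('a \<Rightarrow> 'b::real_inner) \<Rightarrow> real" where
  "l2_norm M X v = sqrt (l2_inner M X v v)"

definition L2_functions :: "'a measure \<Rightarrow> 'a set \<Rightarrow> ('a \<Rightarrow> real) set" where
  "L2_functions M X = {f. set_borel_measurable M X f \<and> set_integrable M X (\<lambda>x. (f x)\<^sup>2)}"

text \<open>
  For a piecewise polynomial this is the elementwise gradient; it is arbitrary on the null set of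
  points where the function is not differentiable.
\<close>

definition grad :: "('a::real_inner \<Rightarrow> real) \<Rightarrow> 'a \<Rightarrow> 'a" where
  "grad v x = (THE D. GDERIV v x :> D)"

text \<open>
  \<open>n \<bullet> \<nabla>v\<close> on the boundary, as the trace from inside: the derivative of \<open>v\<close> at \<open>x\<close> in direction
  \<open>n x\<close>, computed along the inner half line. It equals \<open>n x \<bullet> grad v x\<close> wherever \<open>v\<close> is
  differentiable at \<open>x\<close>, and it remains meaningful where the boundary runs along a mesh face.
\<close>

definition normal_deriv :: "('a::real_normed_vector \<Rightarrow> 'a) \<Rightarrow> ('a \<Rightarrow> real) \<Rightarrow> 'a \<Rightarrow> real" where
  "normal_deriv n v x = vector_derivative (\<lambda>t. v (x + t *\<^sub>R n x)) (at_left 0)"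

section \<open>Meshes and finite element spaces\<close>

definition polys :: "nat \<Rightarrow> (real ^ 'n \<Rightarrow> real) set" where
  "polys k = {p. \<exists>c. \<forall>x. p x = (\<Sum>\<alpha> | sum \<alpha> UNIV \<le> k. c \<alpha> * (\<Prod>i\<in>UNIV. x $ i ^ \<alpha> i))}"

definition simplicial_mesh :: "(real ^ 'n) set \<Rightarrow> (real ^ 'n) set set \<Rightarrow> bool" where
  "simplicial_mesh \<Omega>\<^sub>0 \<T> \<longleftrightarrow>
     triangulation \<T> \<and> (\<forall>T\<in>\<T>. int CARD('n) simplex T) \<and> \<Union>\<T> = \<Omega>\<^sub>0"

definition quasiuniform_family ::
  "(real ^ 'n) set \<Rightarrow> real \<Rightarrow> (real \<Rightarrow> (real ^ 'n) set set) \<Rightarrow> bool" where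
  "quasiuniform_family \<Omega>\<^sub>0 h\<^sub>0 \<T> \<longleftrightarrow>
     (\<forall>h\<in>{0<..h\<^sub>0}. simplicial_mesh \<Omega>\<^sub>0 (\<T> h)) \<and>
     (\<exists>c>0. \<exists>C>0. \<forall>h\<in>{0<..h\<^sub>0}. \<forall>T\<in>\<T> h.
        diameter T \<le> C * h \<and> (\<exists>x. cball x (c * h) \<subseteq> T))"

definition fe_space0 :: "nat \<Rightarrow> (real ^ 'n) set set \<Rightarrow> (real ^ 'n \<Rightarrow> real) set" where
  "fe_space0 k \<T> = {v. continuous_on (\<Union>\<T>) v \<and> (\<forall>T\<in>\<T>. \<exists>p\<in>polys k. \<forall>x\<in>T. v x = p x)}"

definition active_mesh :: "'a set \<Rightarrow> 'a set set \<Rightarrow> 'a set set" where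
  "active_mesh \<Omega> \<T> = {T\<in>\<T>. T \<inter> \<Omega> \<noteq> {}}"

text \<open>
  Functions on the union of the active elements are represented by their extension by zero to the
  whole space, so that equality of elements of \<open>fe_space\<close> is equality on that union.
\<close>

definition fe_space ::
  "nat \<Rightarrow> (real ^ 'n) set \<Rightarrow> (real ^ 'n) set set \<Rightarrow> (real ^ 'n \<Rightarrow> real) set" where
  "fe_space k \<Omega> \<T> =
     (\<lambda>v x. if x \<in> \<Union>(active_mesh \<Omega> \<T>) then v x else 0) ` fe_space0 k \<T>"

text \<open>Lagrange nodes: the points of the simplex with barycentric coordinates in \<open>{0, 1/k, \<dots>, 1}\<close>.\<close>

definition lagrange_nodes :: "nat \<Rightarrow> (real ^ 'n) set \<Rightarrow> (real ^ 'n) set" where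
  "lagrange_nodes k T =
     (let C = {v. v extreme_point_of T}
      in {(\<Sum>v\<in>C. (real (\<alpha> v) / real k) *\<^sub>R v) | \<alpha> :: real ^ 'n \<Rightarrow> nat. sum \<alpha> C = k})"

text \<open>The index set of the nodal basis: the basis functions are indexed by the nodes themselves.\<close>

definition fe_nodes :: "nat \<Rightarrow> (real ^ 'n) set \<Rightarrow> (real ^ 'n) set set \<Rightarrow> (real ^ 'n) set" where
  "fe_nodes k \<Omega> \<T> = (\<Union>T\<in>active_mesh \<Omega> \<T>. lagrange_nodes k T)"

definition nodal_basis ::
  "nat \<Rightarrow> (real ^ 'n) set \<Rightarrow> (real ^ 'n) set set \<Rightarrow> (real ^ 'n \<Rightarrow> real ^ 'n \<Rightarrow> real) \<Rightarrow> bool" where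
  "nodal_basis k \<Omega> \<T> \<phi> \<longleftrightarrow>
     (\<forall>i\<in>fe_nodes k \<Omega> \<T>. \<phi> i \<in> fe_space k \<Omega> \<T> \<and>
        (\<forall>j\<in>fe_nodes k \<Omega> \<T>. \<phi> i j = (if i = j then 1 else 0)))"

definition supp :: "('a::topological_space \<Rightarrow> real) \<Rightarrow> 'a set" where
  "supp v = closure {x. v x \<noteq> 0}"

text \<open>
  Element degree of freedom of \<open>p\<close> on \<open>T\<close> for the index \<open>i\<close>: the coefficient of \<open>\<phi> i\<close> in the expansion of
  \<open>p\<close>, restricted to \<open>T\<close>, in the element basis, which consists of the restrictions to \<open>T\<close> of the
  global basis functions whose support contains \<open>T\<close>. For a polynomial \<open>p\<close> of
  degree at most \<open>k\<close> and the nodal basis this is \<open>p i\<close>.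
\<close>

definition elem_dof ::
  "nat \<Rightarrow> (real ^ 'n) set \<Rightarrow> (real ^ 'n) set set \<Rightarrow> (real ^ 'n \<Rightarrow> real ^ 'n \<Rightarrow> real) \<Rightarrow>
   real ^ 'n \<Rightarrow> (real ^ 'n) set \<Rightarrow> (real ^ 'n \<Rightarrow> real) \<Rightarrow> real" where
  "elem_dof k \<Omega> \<T> \<phi> i T p =
     (THE c. \<exists>a. a i = c \<and>
        (\<forall>x\<in>T. p x = (\<Sum>j | j \<in> fe_nodes k \<Omega> \<T> \<and> T \<subseteq> supp (\<phi> j). a j * \<phi> j x)))"

definition poly_ext ::
  "nat \<Rightarrow> (real ^ 'n) set \<Rightarrow> (real ^ 'n \<Rightarrow> real) \<Rightarrow> real ^ 'n \<Rightarrow> real" where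
  "poly_ext k T v = (THE p. p \<in> polys k \<and> (\<forall>x\<in>T. p x = v x))"

definition jump ::
  "nat \<Rightarrow> (real ^ 'n) set \<Rightarrow> (real ^ 'n) set \<Rightarrow> (real ^ 'n \<Rightarrow> real) \<Rightarrow> real ^ 'n \<Rightarrow> real" where
  "jump k T\<^sub>1 T\<^sub>2 v = (\<lambda>x. poly_ext k T\<^sub>1 v x - poly_ext k T\<^sub>2 v x)"

section \<open>Large and small elements\<close>

definition large_elems ::
  "real \<Rightarrow> (real ^ 'n) set \<Rightarrow> (real ^ 'n) set set \<Rightarrow> (real ^ 'n) set set" where
  "large_elems \<gamma> \<Omega> \<T> =
     {T \<in> active_mesh \<Omega> \<T>. measure lebesgue (T \<inter> \<Omega>) \<ge> \<gamma> * measure lebesgue T}"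

definition small_elems ::
  "real \<Rightarrow> (real ^ 'n) set \<Rightarrow> (real ^ 'n) set set \<Rightarrow> (real ^ 'n) set set" where
  "small_elems \<gamma> \<Omega> \<T> = active_mesh \<Omega> \<T> - large_elems \<gamma> \<Omega> \<T>"

definition small_nodes ::
  "nat \<Rightarrow> real \<Rightarrow> (real ^ 'n) set \<Rightarrow> (real ^ 'n) set set \<Rightarrow> (real ^ 'n \<Rightarrow> real ^ 'n \<Rightarrow> real) \<Rightarrow>
   (real ^ 'n) set" where
  "small_nodes k \<gamma> \<Omega> \<T> \<phi> =
     {i \<in> fe_nodes k \<Omega> \<T>. \<not> (\<exists>T\<in>large_elems \<gamma> \<Omega> \<T>. T \<subseteq> supp (\<phi> i))}"

definition large_nodes ::
  "nat \<Rightarrow> real \<Rightarrow> (real ^ 'n) set \<Rightarrow> (real ^ 'n) set set \<Rightarrow> (real ^ 'n \<Rightarrow> real ^ 'n \<Rightarrow> real) \<Rightarrow>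
   (real ^ 'n) set" where
  "large_nodes k \<gamma> \<Omega> \<T> \<phi> = fe_nodes k \<Omega> \<T> - small_nodes k \<gamma> \<Omega> \<T> \<phi>"

definition element_choice ::
  "nat \<Rightarrow> real \<Rightarrow> (real ^ 'n) set \<Rightarrow> (real ^ 'n) set set \<Rightarrow> (real ^ 'n \<Rightarrow> real ^ 'n \<Rightarrow> real) \<Rightarrow>
   (real ^ 'n \<Rightarrow> (real ^ 'n) set) \<Rightarrow> bool" where
  "element_choice k \<gamma> \<Omega> \<T> \<phi> t \<longleftrightarrow>
     (\<forall>i\<in>small_nodes k \<gamma> \<Omega> \<T> \<phi>. t i \<in> active_mesh \<Omega> \<T> \<and> t i \<subseteq> supp (\<phi> i)) \<and>
     (\<forall>i\<in>large_nodes k \<gamma> \<Omega> \<T> \<phi>. t i \<in> large_elems \<gamma> \<Omega> \<T> \<and> t i \<subseteq> supp (\<phi> i))"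

section \<open>The extension operator and the method\<close>

definition ext_op ::
  "nat \<Rightarrow> real \<Rightarrow> (real ^ 'n) set \<Rightarrow> (real ^ 'n) set set \<Rightarrow> (real ^ 'n \<Rightarrow> real ^ 'n \<Rightarrow> real) \<Rightarrow>
   ((real ^ 'n) set \<Rightarrow> (real ^ 'n) set) \<Rightarrow> (real ^ 'n \<Rightarrow> (real ^ 'n) set) \<Rightarrow>
   (real ^ 'n \<Rightarrow> real) \<Rightarrow> real ^ 'n \<Rightarrow> real" where
  "ext_op k \<gamma> \<Omega> \<T> \<phi> S t v = (\<lambda>x.
     (\<Sum>i\<in>small_nodes k \<gamma> \<Omega> \<T> \<phi>. elem_dof k \<Omega> \<T> \<phi> i (t i) (poly_ext k (S (t i)) v) * \<phi> i x) +
     (\<Sum>i\<in>large_nodes k \<gamma> \<Omega> \<T> \<phi>. elem_dof k \<Omega> \<T> \<phi> i (t i) v * \<phi> i x))"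

definition a_form ::
  "(real ^ 'n) set \<Rightarrow> (real ^ 'n \<Rightarrow> real ^ 'n) \<Rightarrow> real \<Rightarrow> real \<Rightarrow>
   (real ^ 'n \<Rightarrow> real) \<Rightarrow> (real ^ 'n \<Rightarrow> real) \<Rightarrow> real" where
  "a_form \<Omega> n \<beta> h v w =
     l2_inner lebesgue \<Omega> (grad v) (grad w)
     - l2_inner surface_measure (frontier \<Omega>) (normal_deriv n v) w
     - l2_inner surface_measure (frontier \<Omega>) v (normal_deriv n w)
     + \<beta> * inverse h * l2_inner surface_measure (frontier \<Omega>) v w"

definition s_form ::
  "nat \<Rightarrow> real \<Rightarrow> (real ^ 'n) set \<Rightarrow> (real ^ 'n) set set \<Rightarrow> (real ^ 'n \<Rightarrow> real ^ 'n \<Rightarrow> real) \<Rightarrow>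
   ((real ^ 'n) set \<Rightarrow> (real ^ 'n) set) \<Rightarrow> (real ^ 'n \<Rightarrow> (real ^ 'n) set) \<Rightarrow> real \<Rightarrow> real \<Rightarrow>
   (real ^ 'n \<Rightarrow> real) \<Rightarrow> (real ^ 'n \<Rightarrow> real) \<Rightarrow> real" where
  "s_form k \<gamma> \<Omega> \<T> \<phi> S t h \<tau> v w =
     (\<Sum>i\<in>small_nodes k \<gamma> \<Omega> \<T> \<phi>. \<tau> * h powi (int CARD('n) - 2) *
        elem_dof k \<Omega> \<T> \<phi> i (t i) (jump k (t i) (S (t i)) v) *
        elem_dof k \<Omega> \<T> \<phi> i (t i) (jump k (t i) (S (t i)) w))"

definition inverse_inequality ::
  "nat \<Rightarrow> real \<Rightarrow> (real ^ 'n) set \<Rightarrow> (real ^ 'n \<Rightarrow> real ^ 'n) \<Rightarrow> real \<Rightarrow>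
   (real \<Rightarrow> (real ^ 'n) set set) \<Rightarrow> (real \<Rightarrow> real ^ 'n \<Rightarrow> real ^ 'n \<Rightarrow> real) \<Rightarrow>
   (real \<Rightarrow> (real ^ 'n) set \<Rightarrow> (real ^ 'n) set) \<Rightarrow> (real \<Rightarrow> real ^ 'n \<Rightarrow> (real ^ 'n) set) \<Rightarrow>
   real \<Rightarrow> real \<Rightarrow> bool" where
  "inverse_inequality k \<gamma> \<Omega> n h\<^sub>0 \<T> \<phi> S t C\<^sub>I \<tau>\<^sub>s \<longleftrightarrow>
     (\<forall>h\<in>{0<..h\<^sub>0}. \<forall>v\<in>fe_space k \<Omega> (\<T> h).
        h * (l2_norm surface_measure (frontier \<Omega>) (normal_deriv n v))\<^sup>2
        \<le> C\<^sub>I * ((l2_norm lebesgue \<Omega> (grad v))\<^sup>2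
                 + s_form k \<gamma> \<Omega> (\<T> h) (\<phi> h) (S h) (t h) h \<tau>\<^sub>s v v))"

definition discrete_solution ::
  "nat \<Rightarrow> real \<Rightarrow> (real ^ 'n) set \<Rightarrow> (real ^ 'n \<Rightarrow> real ^ 'n) \<Rightarrow> (real ^ 'n) set set \<Rightarrow>
   (real ^ 'n \<Rightarrow> real ^ 'n \<Rightarrow> real) \<Rightarrow> ((real ^ 'n) set \<Rightarrow> (real ^ 'n) set) \<Rightarrow>
   (real ^ 'n \<Rightarrow> (real ^ 'n) set) \<Rightarrow> real \<Rightarrow> real \<Rightarrow> real \<Rightarrow> (real ^ 'n \<Rightarrow> real) \<Rightarrow>
   (real ^ 'n \<Rightarrow> real) \<Rightarrow> bool" where
  "discrete_solution k \<gamma> \<Omega> n \<T> \<phi> S t \<beta> h \<tau> f u \<longleftrightarrow>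
     u \<in> fe_space k \<Omega> \<T> \<and>
     (\<forall>v\<in>fe_space k \<Omega> \<T>.
        a_form \<Omega> n \<beta> h u v + s_form k \<gamma> \<Omega> \<T> \<phi> S t h \<tau> u v = l2_inner lebesgue \<Omega> f v)"

definition is_norm_on :: "('a \<Rightarrow> real) set \<Rightarrow> (('a \<Rightarrow> real) \<Rightarrow> real) \<Rightarrow> bool" where
  "is_norm_on V N \<longleftrightarrow>
     (\<forall>v\<in>V. N v \<ge> 0 \<and> (N v = 0 \<longleftrightarrow> v = (\<lambda>x. 0))) \<and>
     (\<forall>v\<in>V. \<forall>c. N (\<lambda>x. c * v x) = \<bar>c\<bar> * N v) \<and>
     (\<forall>v\<in>V. \<forall>w\<in>V. N (\<lambda>x. v x + w x) \<le> N v + N w)"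

text \<open>
  Convergence to zero in the finite-dimensional space \<open>V\<close>, whose norms are all equivalent. Asking for
  every norm avoids singling one out.
\<close>

definition tends_to_zero_in :: "('a \<Rightarrow> real) set \<Rightarrow> (real \<Rightarrow> 'a \<Rightarrow> real) \<Rightarrow> real filter \<Rightarrow> bool" where
  "tends_to_zero_in V w F \<longleftrightarrow>
     (\<forall>N. is_norm_on V N \<longrightarrow> ((\<lambda>\<tau>. N (w \<tau>)) \<longlongrightarrow> 0) F)"

end

theory Submission
  imports Defs "HOL-Library.Function_Algebras"
begin

text \<open>
  The Young inequality and the inverse inequality make \<open>b = a\<^sub>h + s\<^sub>h\<close>, with the stabilization taken at
  the fixed parameter \<open>\<tau>\<^sub>s\<close>, positive semidefinite on the finite element space once \<open>\<beta> \<ge> C\<^sub>I\<close>. Since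
  the solution \<open>w\<close> for one parameter \<open>\<tau>\<^sub>1\<close> represents the right hand side, testing the equation for
  \<open>u = u\<^sub>\<tau>\<close> with \<open>u\<close> and estimating the mixed terms by \<open>b(u - w, u - w) \<ge> 0\<close> gives
  \<open>(\<tau> - \<tau>\<^sub>1) \<sigma>(u, u) \<le> C\<close>, where \<open>\<sigma>\<close> is the stabilization form with parameter 1. Hence the jump degrees
  of freedom vanish in the limit, and they are the coefficients of \<open>u - \<Pi> u\<close> in the nodal basis.
  Neither coercivity nor a Poincare inequality is needed.
\<close>

section \<open>Polynomials\<close>

text \<open>Much of the work is to give the forms their algebra. \<open>poly_ext\<close>,
  \<open>elem_dof\<close> and \<open>grad\<close> are definite descriptions and
  \<open>normal_deriv\<close> is a choice of one-sided derivative, so their linearity in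
  \<open>v\<close> has to be earned. Unisolvence of the Lagrange nodes on each simplex turns a
  degree of freedom into a point value. On the analytic side, the integral of a nonintegrable
  function is 0 by convention, so even the expansion of \<open>a\<^sub>h(u - w, u - w)\<close> rests
  on measurability and bounds for gradients, traces and normal derivatives; the first and the last
  of these are controlled only almost everywhere.\<close>

lemma finite_multi_indices: "finite {\<alpha> :: 'n::finite \<Rightarrow> nat. sum \<alpha> UNIV \<le> k}"
proof (rule finite_subset)
  show "{\<alpha> :: 'n \<Rightarrow> nat. sum \<alpha> UNIV \<le> k} \<subseteq> PiE UNIV (\<lambda>_. {..k})"
  proof
    fix \<alpha> :: "'n \<Rightarrow> nat" assume "\<alpha> \<in> {\<alpha>. sum \<alpha> UNIV \<le> k}"
    then have "\<alpha> i \<le> k" for i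
      using member_le_sum[of i UNIV \<alpha>] by simp
    then show "\<alpha> \<in> PiE UNIV (\<lambda>_. {..k})" by auto
  qed
qed (auto intro: finite_PiE)

lemma polys_zero [simp]: "(\<lambda>x. 0) \<in> polys k"
  by (auto simp: polys_def intro!: exI[of _ "\<lambda>_. 0"])

lemma polys_add: "p \<in> polys k \<Longrightarrow> q \<in> polys k \<Longrightarrow> (\<lambda>x. p x + q x) \<in> polys k"
proof -
  assume "p \<in> polys k" "q \<in> polys k"
  then obtain c d where "\<forall>x. p x = (\<Sum>\<alpha> | sum \<alpha> UNIV \<le> k. c \<alpha> * (\<Prod>i\<in>UNIV. x $ i ^ \<alpha> i))"
    "\<forall>x. q x = (\<Sum>\<alpha> | sum \<alpha> UNIV \<le> k. d \<alpha> * (\<Prod>i\<in>UNIV. x $ i ^ \<alpha> i))"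
    unfolding polys_def by auto
  then show ?thesis
    unfolding polys_def by (auto simp: sum.distrib ring_distribs intro!: exI[of _ "\<lambda>\<alpha>. c \<alpha> + d \<alpha>"])
qed

lemma polys_scale: "p \<in> polys k \<Longrightarrow> (\<lambda>x. a * p x) \<in> polys k"
proof -
  assume "p \<in> polys k"
  then obtain c where "\<forall>x. p x = (\<Sum>\<alpha> | sum \<alpha> UNIV \<le> k. c \<alpha> * (\<Prod>i\<in>UNIV. x $ i ^ \<alpha> i))"
    unfolding polys_def by auto
  then show ?thesis
    unfolding polys_def by (auto simp: sum_distrib_left mult.assoc intro!: exI[of _ "\<lambda>\<alpha>. a * c \<alpha>"])
qed

lemma polys_diff: "p \<in> polys k \<Longrightarrow> q \<in> polys k \<Longrightarrow> (\<lambda>x. p x - q x) \<in> polys k"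
  using polys_add[of p k "\<lambda>x. (-1) * q x"] polys_scale[of q k "-1"] by simp

lemma polys_sum: "(\<And>j. j \<in> J \<Longrightarrow> p j \<in> polys k) \<Longrightarrow> (\<lambda>x. \<Sum>j\<in>J. a j * p j x) \<in> polys k"
  by (induction J rule: infinite_finite_induct) (auto intro!: polys_add polys_scale)

section \<open>Gradients of polynomials and the identity theorem\<close>

lemma polys_real_polynomial_function:
  assumes "p \<in> polys k" shows "real_polynomial_function p"
proof -
  obtain c where c: "p = (\<lambda>x. \<Sum>\<alpha> | sum \<alpha> UNIV \<le> k. c \<alpha> * (\<Prod>i\<in>UNIV. x $ i ^ \<alpha> i))"
    using assms unfolding polys_def by auto
  show ?thesis
    unfolding c
    by (intro real_polynomial_function_sum finite_multi_indices real_polynomial_function.intros(4)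
        real_polynomial_function.intros(2) real_polynomial_function_prod real_polynomial_function_power
        real_polynomial_function.intros(1) bounded_linear_vec_nth) auto
qed

text \<open>Induction over the construction of the polynomial delivers the gradient together with
  its continuity, which later yields bounds on compact elements and Borel measurability.\<close>

lemma real_polynomial_function_GDERIV:
  fixes p :: "'a::euclidean_space \<Rightarrow> real"
  assumes "real_polynomial_function p"
  obtains G where "continuous_on UNIV G" "\<And>x. GDERIV p x :> G x"
proof -
  have "\<exists>G. continuous_on UNIV G \<and> (\<forall>x. GDERIV p x :> G x)"
    using assms
  proof induction
    case (linear f)
    interpret bounded_linear f by fact
    \<comment> \<open>The Riesz vector of the functional, assembled from its values on the
      basis.\<close>
    have "f = (\<lambda>h. h \<bullet> (\<Sum>b\<in>Basis. f b *\<^sub>R b))"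
    proof
      fix h
      have "f h = f (\<Sum>b\<in>Basis. (h \<bullet> b) *\<^sub>R b)"
        by (simp add: euclidean_representation)
      then show "f h = h \<bullet> (\<Sum>b\<in>Basis. f b *\<^sub>R b)"
        by (simp add: sum scaleR inner_sum_right mult.commute)
    qed
    then have "GDERIV f x :> (\<Sum>b\<in>Basis. f b *\<^sub>R b)" for x
      unfolding gderiv_def using has_derivative[OF has_derivative_ident, of "at x"] by simp
    then show ?case
      by (intro exI[of _ "\<lambda>x. \<Sum>b\<in>Basis. f b *\<^sub>R b"]) auto
  next
    case (const c)
    then show ?case
      by (intro exI[of _ "\<lambda>x. 0"]) (auto intro: GDERIV_const)
  next
    case (add f g)
    then obtain F G where "continuous_on UNIV F" "\<And>x. GDERIV f x :> F x"
      "continuous_on UNIV G" "\<And>x. GDERIV g x :> G x" by blast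
    then show ?case
      by (intro exI[of _ "\<lambda>x. F x + G x"]) (auto intro: GDERIV_add continuous_on_add)
  next
    case (mult f g)
    then obtain F G where FG: "continuous_on UNIV F" "\<And>x. GDERIV f x :> F x"
      "continuous_on UNIV G" "\<And>x. GDERIV g x :> G x" by blast
    have "continuous_on UNIV f" "continuous_on UNIV g"
      using mult.hyps continuous_on_polymonial_function real_polynomial_function_eq by blast+
    with FG show ?case
      by (intro exI[of _ "\<lambda>x. f x *\<^sub>R G x + g x *\<^sub>R F x"])
        (auto intro!: GDERIV_mult continuous_intros)
  qed
  with that show thesis by blast
qed

text \<open>On the line from an interior point \<open>z\<close> of \<open>A\<close> to
  \<open>x\<close> the polynomial is univariate, and a short segment of that line stays in
  \<open>A\<close>. This gives infinitely many roots, so it vanishes on the whole line.\<close>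

lemma real_polynomial_function_eq_zero:
  fixes p :: "'a::real_normed_vector \<Rightarrow> real"
  assumes "real_polynomial_function p" "interior A \<noteq> {}" "\<And>x. x \<in> A \<Longrightarrow> p x = 0"
  shows "p x = 0"
proof -
  obtain z r where r: "r > 0" "ball z r \<subseteq> A"
    using assms(2) by (metis ex_in_conv mem_interior)
  define d where "d = x - z"
  have "real_polynomial_function (p \<circ> (\<lambda>t::real. z + t *\<^sub>R d))"
    by (rule real_polynomial_function_compose[OF _ assms(1)])
      (simp add: polynomial_function_add polynomial_function_mult real_polynomial_function_eq)
  then obtain a m where a: "p \<circ> (\<lambda>t::real. z + t *\<^sub>R d) = (\<lambda>t. \<Sum>i\<le>m. a i * t ^ i)"
    using real_polynomial_function_imp_sum by blast
  \<comment> \<open>The \<open>+ 1\<close> keeps the bound meaningful when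
    \<open>d = 0\<close>.\<close>
  have "p (z + t *\<^sub>R d) = 0" if "t \<in> {0<..<r / (norm d + 1)}" for t
  proof (rule assms(3))
    have "norm (t *\<^sub>R d) = t * norm d" using that by simp
    also have "\<dots> \<le> t * (norm d + 1)" using that by simp
    also have "\<dots> < r" using that by (simp add: pos_less_divide_eq add_nonneg_pos)
    finally show "z + t *\<^sub>R d \<in> A"
      using r(2) by (auto simp: dist_norm)
  qed
  then have "{0<..<r / (norm d + 1)} \<subseteq> {t. (\<Sum>i\<le>m. a i * t ^ i) = 0}"
    using a by (auto simp: fun_eq_iff)
  moreover have "infinite {0<..<r / (norm d + 1)}"
    using r(1) by (simp add: infinite_Ioo add_nonneg_pos)
  ultimately have "\<forall>i\<le>m. a i = 0"
    using polyfun_finite_roots[where n = m and c = a] finite_subset by blast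
  then have "p (z + 1 *\<^sub>R d) = 0"
    using fun_cong[OF a, of 1] by simp
  then show ?thesis by (simp add: d_def)
qed

text \<open>Supplies the uniqueness behind the definite description in
  \<open>poly_ext\<close>.\<close>

lemma polys_eqI:
  assumes "p \<in> polys k" "q \<in> polys k" "interior A \<noteq> {}" "\<And>x. x \<in> A \<Longrightarrow> p x = q x"
  shows "p = q"
  using real_polynomial_function_eq_zero[OF polys_real_polynomial_function[OF polys_diff[OF assms(1,2)]] assms(3)]
    assms(4) by fastforce

section \<open>Lagrange nodes and unisolvence\<close>

text \<open>\<open>lagrange_nodes\<close> speaks of extreme points, \<open>simplex\<close> of some
  affinely independent vertex set; for the convex hull of such a set the two coincide.\<close>

lemma simplex_extreme_points:
  fixes T :: "'a::euclidean_space set"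
  assumes "m simplex T"
  shows "finite {v. v extreme_point_of T}" "\<not> affine_dependent {v. v extreme_point_of T}"
    "int (card {v. v extreme_point_of T}) = m + 1" "T = convex hull {v. v extreme_point_of T}"
proof -
  obtain C where C: "\<not> affine_dependent C" "int (card C) = m + 1" "T = convex hull C"
    using assms unfolding simplex_def by blast
  have "C = {v. v extreme_point_of T}"
    using C extreme_point_of_convex_hull_affine_independent[OF C(1)] by blast
  then show "finite {v. v extreme_point_of T}" "\<not> affine_dependent {v. v extreme_point_of T}"
    "int (card {v. v extreme_point_of T}) = m + 1" "T = convex hull {v. v extreme_point_of T}"
    using C aff_independent_finite[OF C(1)] by argo+
qed

lemma lagrange_nodes_subset:
  assumes "m simplex T" "k \<ge> 1"
  shows "lagrange_nodes k T \<subseteq> T"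
proof
  fix x assume "x \<in> lagrange_nodes k T"
  then obtain \<alpha> :: "real ^ 'a \<Rightarrow> nat" where
    \<alpha>: "x = (\<Sum>v | v extreme_point_of T. (real (\<alpha> v) / real k) *\<^sub>R v)"
      "sum \<alpha> {v. v extreme_point_of T} = k"
    by (auto simp: lagrange_nodes_def Let_def)
  have "(\<Sum>v | v extreme_point_of T. real (\<alpha> v) / real k) = 1"
    using assms(2) by (simp flip: \<alpha>(2) sum_divide_distrib of_nat_sum)
  then have "x \<in> convex hull {v. v extreme_point_of T}"
    unfolding \<alpha>(1) using simplex_extreme_points(1)[OF assms(1)]
    by (intro convex_sum convex_convex_hull) (auto intro: hull_inc)
  then show "x \<in> T"
    using simplex_extreme_points(4)[OF assms(1)] by simp
qed

text \<open>The weight functions \<open>\<alpha>\<close> are infinite in number, their values away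
  from the vertices being free; only the restriction to the vertices enters the node.\<close>

lemma finite_lagrange_nodes:
  fixes T :: "(real ^ 'n) set"
  assumes "m simplex T"
  shows "finite (lagrange_nodes k T)"
proof -
  define C where "C = {v. v extreme_point_of T}"
  have fin: "finite C" using simplex_extreme_points(1)[OF assms] by (simp add: C_def)
  define L where "L = (\<lambda>\<alpha> :: real ^ 'n \<Rightarrow> nat. \<Sum>v\<in>C. (real (\<alpha> v) / real k) *\<^sub>R v)"
  have "lagrange_nodes k T \<subseteq> L ` (PiE C (\<lambda>_. {..k}))"
  proof
    fix x assume "x \<in> lagrange_nodes k T"
    then obtain \<alpha> where \<alpha>: "x = L \<alpha>" "sum \<alpha> C = k"
      by (auto simp: lagrange_nodes_def Let_def C_def L_def)
    have "\<alpha> v \<le> k" if "v \<in> C" for v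
      using member_le_sum[of v C \<alpha>] that fin \<alpha>(2) by simp
    moreover have "x = L (restrict \<alpha> C)"
      unfolding \<alpha>(1) L_def by (rule sum.cong) auto
    ultimately show "x \<in> L ` (PiE C (\<lambda>_. {..k}))" by auto
  qed
  then show ?thesis
    by (rule finite_subset) (auto intro!: finite_PiE fin)
qed

text \<open>The exponents of a monomial become barycentric weights at all vertices but one, and
  \<open>v0\<close> receives the degree missing to \<open>k\<close>. Affine independence recovers
  the weights from the node, so distinct monomials give distinct nodes.\<close>

lemma card_lagrange_nodes_ge:
  fixes T :: "(real ^ 'n) set"
  assumes "int CARD('n) simplex T" "k \<ge> 1"
  shows "card {\<alpha> :: 'n \<Rightarrow> nat. sum \<alpha> UNIV \<le> k} \<le> card (lagrange_nodes k T)"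
proof -
  define C where "C = {v. v extreme_point_of T}"
  have fin: "finite C" and indep: "\<not> affine_dependent C" and card: "card C = CARD('n) + 1"
    using simplex_extreme_points[OF assms(1)] by (simp_all add: C_def)
  obtain v0 where v0: "v0 \<in> C" using card by fastforce
  obtain g where g: "bij_betw g (UNIV :: 'n set) (C - {v0})"
    using finite_same_card_bij[of "UNIV :: 'n set" "C - {v0}"] fin card v0 by auto
  define L where "L = (\<lambda>\<beta> :: real ^ 'n \<Rightarrow> nat. \<Sum>v\<in>C. (real (\<beta> v) / real k) *\<^sub>R v)"
  have L_inj: "\<beta> v = \<beta>' v"
    if eq: "L \<beta> = L \<beta>'" "sum \<beta> C = k" "sum \<beta>' C = k" and v: "v \<in> C" for \<beta> \<beta>' v
  proof (rule ccontr)
    assume "\<beta> v \<noteq> \<beta>' v"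
    \<comment> \<open>The difference of two weight functions for the same point is a nontrivial
      affine relation between the vertices.\<close>
    define U where "U v = real (\<beta> v) / real k - real (\<beta>' v) / real k" for v
    have "sum U C = real (sum \<beta> C) / real k - real (sum \<beta>' C) / real k"
      unfolding U_def by (simp add: sum_subtractf sum_divide_distrib)
    then have "sum U C = 0" using eq by simp
    moreover have "U v \<noteq> 0" using \<open>\<beta> v \<noteq> \<beta>' v\<close> assms(2) by (simp add: U_def)
    moreover have "(\<Sum>v\<in>C. U v *\<^sub>R v) = 0"
      using eq(1) by (simp add: U_def L_def scaleR_diff_left sum_subtractf)
    ultimately show False
      using indep v unfolding affine_dependent_explicit_finite[OF fin] by blast
  qed
  define E where "E \<alpha> v = (if v = v0 then k - sum \<alpha> UNIV else \<alpha> (inv_into UNIV g v))"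
    for \<alpha> :: "'n \<Rightarrow> nat" and v
  have E_g: "E \<alpha> (g i) = \<alpha> i" for \<alpha> i
    using bij_betw_inv_into_left[OF g, of i] bij_betwE[OF g] by (simp add: E_def)
  have E_sum: "sum (E \<alpha>) C = k" if "sum \<alpha> UNIV \<le> k" for \<alpha>
  proof -
    have "sum (E \<alpha>) C = E \<alpha> v0 + sum (E \<alpha>) (C - {v0})"
      using fin v0 by (simp add: sum.remove)
    also have "sum (E \<alpha>) (C - {v0}) = sum \<alpha> UNIV"
      using sum.reindex_bij_betw[OF g, of "E \<alpha>"] by (simp add: E_g)
    finally show ?thesis using that by (simp add: E_def)
  qed
  have "inj_on (\<lambda>\<alpha>. L (E \<alpha>)) {\<alpha>. sum \<alpha> UNIV \<le> k}"
  proof (rule inj_onI, rule ext)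
    fix \<alpha> \<alpha>' :: "'n \<Rightarrow> nat" and i
    assume "\<alpha> \<in> {\<alpha>. sum \<alpha> UNIV \<le> k}" "\<alpha>' \<in> {\<alpha>. sum \<alpha> UNIV \<le> k}" "L (E \<alpha>) = L (E \<alpha>')"
    then have "E \<alpha> (g i) = E \<alpha>' (g i)"
      using L_inj[of "E \<alpha>" "E \<alpha>'" "g i"] bij_betwE[OF g] by (simp add: E_sum)
    then show "\<alpha> i = \<alpha>' i" by (simp add: E_g)
  qed
  moreover have "(\<lambda>\<alpha>. L (E \<alpha>)) ` {\<alpha>. sum \<alpha> UNIV \<le> k} \<subseteq> lagrange_nodes k T"
    using E_sum by (auto simp: lagrange_nodes_def Let_def L_def simp flip: C_def)
  ultimately show ?thesis
    using finite_lagrange_nodes[OF assms(1)] card_inj_on_le by blast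
qed

section \<open>Linear algebra in the space of real functions: unisolvence\<close>

lemma sum_fun_apply: "(\<Sum>i\<in>A. f i) x = (\<Sum>i\<in>A. f i x)"
  by (induction A rule: infinite_finite_induct) auto

interpretation fun_vs: vector_space "\<lambda>(c::real) f x. c * f x"
  by unfold_locales (auto simp: fun_eq_iff algebra_simps)

lemma polys_subset_span:
  "polys k \<subseteq> fun_vs.span ((\<lambda>\<alpha> (x :: real ^ 'n). \<Prod>i\<in>UNIV. x $ i ^ \<alpha> i) ` {\<alpha>. sum \<alpha> UNIV \<le> k})"
proof
  fix p :: "real ^ 'n \<Rightarrow> real" assume "p \<in> polys k"
  then obtain c where c: "p = (\<lambda>x. \<Sum>\<alpha> | sum \<alpha> UNIV \<le> k. c \<alpha> * (\<Prod>i\<in>UNIV. x $ i ^ \<alpha> i))"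
    unfolding polys_def by auto
  have "p = (\<Sum>\<alpha> | sum \<alpha> UNIV \<le> k. (\<lambda>x. c \<alpha> * (\<Prod>i\<in>UNIV. x $ i ^ \<alpha> i)))"
    by (simp add: c fun_eq_iff sum_fun_apply)
  then show "p \<in> fun_vs.span ((\<lambda>\<alpha> (x :: real ^ 'n). \<Prod>i\<in>UNIV. x $ i ^ \<alpha> i) ` {\<alpha>. sum \<alpha> UNIV \<le> k})"
    by (auto intro!: fun_vs.span_sum fun_vs.span_scale[of "\<lambda>x. \<Prod>i\<in>UNIV. x $ i ^ _ i"] intro: fun_vs.span_base)
qed

text \<open>
  Dimension count: the functions \<open>P j\<close> are independent and at least as many as the monomials, so a
  polynomial outside their span would give too large an independent set.
\<close>

lemma polys_nodal_expansion:
  fixes P :: "real ^ 'n \<Rightarrow> real ^ 'n \<Rightarrow> real"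
  assumes "finite L" "card {\<alpha> :: 'n \<Rightarrow> nat. sum \<alpha> UNIV \<le> k} \<le> card L"
    and P: "\<And>i. i \<in> L \<Longrightarrow> P i \<in> polys k"
    and \<delta>: "\<And>i j. i \<in> L \<Longrightarrow> j \<in> L \<Longrightarrow> P i j = (if i = j then 1 else 0)"
    and p: "p \<in> polys k"
  shows "p x = (\<Sum>j\<in>L. p j * P j x)"
proof -
  \<comment> \<open>The interpolation error vanishes at every node. Once it lies in the span of the
    \<open>P j\<close>, its coefficients can be read off at the nodes and are all 0.\<close>
  define q where "q = (\<lambda>x. p x - (\<Sum>j\<in>L. p j * P j x))"
  have q: "q \<in> polys k"
    unfolding q_def using P by (intro polys_diff p polys_sum) auto
  have q0: "q j = 0" if "j \<in> L" for j
    using that assms(1) by (simp add: q_def \<delta> if_distrib cong: if_cong)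
  have inj: "inj_on P L"
    using \<delta> by (intro inj_onI) (metis zero_neq_one)
  have indep: "fun_vs.independent (P ` L)"
    unfolding fun_vs.independent_explicit_finite_subsets
  proof (intro allI impI ballI)
    fix S u v assume S: "S \<subseteq> P ` L" "finite S" "(\<Sum>v\<in>S. (\<lambda>x. u v * v x)) = 0" and v: "v \<in> S"
    obtain i where i: "i \<in> L" "v = P i" using S v by auto
    have wi: "w i = (if w = v then 1 else 0)" if "w \<in> S" for w
      using that S(1) i \<delta> by auto
    have "(\<Sum>w\<in>S. u w * w i) = (\<Sum>w\<in>S. if w = v then u w else 0)"
    proof (rule sum.cong)
      show "u w * w i = (if w = v then u w else 0)" if "w \<in> S" for w
        by (cases "w = v") (use wi[OF that] in auto)
    qed simp
    moreover have "(\<Sum>w\<in>S. u w * w i) = 0"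
      using fun_cong[OF S(3), of i] by (simp add: sum_fun_apply)
    ultimately show "u v = 0" using S(2) v by simp
  qed
  have "q \<in> fun_vs.span (P ` L)"
  proof (rule ccontr)
    assume nin: "q \<notin> fun_vs.span (P ` L)"
    then have "q \<notin> P ` L" by (auto intro: fun_vs.span_base)
    let ?M = "(\<lambda>\<alpha> (x :: real ^ 'n). \<Prod>i\<in>UNIV. x $ i ^ \<alpha> i) ` {\<alpha>. sum \<alpha> UNIV \<le> k}"
    have "card (insert q (P ` L)) \<le> card ?M"
      using fun_vs.independent_span_bound[of ?M "insert q (P ` L)"]
        fun_vs.independent_insertI[OF nin indep] polys_subset_span[of k] P q finite_multi_indices
      by blast
    also have "\<dots> \<le> card L"
      using assms(2) card_image_le[OF finite_multi_indices] order_trans by blast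
    finally show False
      using assms(1) inj \<open>q \<notin> P ` L\<close> by (simp add: card_image)
  qed
  then obtain r where "q = (\<Sum>v\<in>P ` L. (\<lambda>x. r v * v x))"
    using fun_vs.span_finite[of "P ` L"] assms(1) by auto
  then have r: "q y = (\<Sum>j\<in>L. r (P j) * P j y)" for y
    by (simp add: sum_fun_apply sum.reindex[OF inj])
  have "r (P i) = 0" if "i \<in> L" for i
  proof -
    have "(\<Sum>j\<in>L. r (P j) * P j i) = (\<Sum>j\<in>L. if j = i then r (P j) else 0)"
      using \<delta> that by (intro sum.cong) auto
    then show ?thesis using r[of i] q0[OF that] that assms(1) by simp
  qed
  then have "q x = 0" by (simp add: r)
  then show ?thesis by (simp add: q_def)
qed

section \<open>Finite element functions and element degrees of freedom\<close>

lemma fe_spaceE: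
  assumes "v \<in> fe_space k \<Omega> \<T>"
  obtains v\<^sub>0 where "v\<^sub>0 \<in> fe_space0 k \<T>" "v = (\<lambda>x. if x \<in> \<Union>(active_mesh \<Omega> \<T>) then v\<^sub>0 x else 0)"
  using assms unfolding fe_space_def by blast

lemma fe_space_add:
  assumes "v \<in> fe_space k \<Omega> \<T>" "w \<in> fe_space k \<Omega> \<T>"
  shows "(\<lambda>x. v x + w x) \<in> fe_space k \<Omega> \<T>"
proof -
  obtain v\<^sub>0 where
    v: "v\<^sub>0 \<in> fe_space0 k \<T>" "v = (\<lambda>x. if x \<in> \<Union>(active_mesh \<Omega> \<T>) then v\<^sub>0 x else 0)"
    using assms(1) by (rule fe_spaceE)
  obtain w\<^sub>0 where
    w: "w\<^sub>0 \<in> fe_space0 k \<T>" "w = (\<lambda>x. if x \<in> \<Union>(active_mesh \<Omega> \<T>) then w\<^sub>0 x else 0)"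
    using assms(2) by (rule fe_spaceE)
  note 0 = v w
  have "\<exists>p\<in>polys k. \<forall>x\<in>T. v\<^sub>0 x + w\<^sub>0 x = p x" if "T \<in> \<T>" for T
  proof -
    obtain p q where "p \<in> polys k" "\<forall>x\<in>T. v\<^sub>0 x = p x" "q \<in> polys k" "\<forall>x\<in>T. w\<^sub>0 x = q x"
      using 0(1,3) \<open>T \<in> \<T>\<close> unfolding fe_space0_def by blast
    then show ?thesis by (intro bexI[of _ "\<lambda>x. p x + q x"]) (auto intro: polys_add)
  qed
  then have "(\<lambda>x. v\<^sub>0 x + w\<^sub>0 x) \<in> fe_space0 k \<T>"
    using 0(1,3) by (simp add: fe_space0_def continuous_on_add)
  moreover have eq: "(\<lambda>x. v x + w x) = (\<lambda>x. if x \<in> \<Union>(active_mesh \<Omega> \<T>) then v\<^sub>0 x + w\<^sub>0 x else 0)"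
    unfolding 0(2,4) by (rule ext) simp
  ultimately show ?thesis
    unfolding fe_space_def eq by (intro imageI)
qed

lemma fe_space_scale:
  assumes "v \<in> fe_space k \<Omega> \<T>"
  shows "(\<lambda>x. c * v x) \<in> fe_space k \<Omega> \<T>"
proof -
  obtain v\<^sub>0 where
    0: "v\<^sub>0 \<in> fe_space0 k \<T>" "v = (\<lambda>x. if x \<in> \<Union>(active_mesh \<Omega> \<T>) then v\<^sub>0 x else 0)"
    using assms(1) by (rule fe_spaceE)
  have "\<exists>p\<in>polys k. \<forall>x\<in>T. c * v\<^sub>0 x = p x" if "T \<in> \<T>" for T
  proof -
    obtain p where "p \<in> polys k" "\<forall>x\<in>T. v\<^sub>0 x = p x"
      using 0(1) \<open>T \<in> \<T>\<close> unfolding fe_space0_def by blast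
    then show ?thesis by (intro bexI[of _ "\<lambda>x. c * p x"]) (auto intro: polys_scale)
  qed
  then have "(\<lambda>x. c * v\<^sub>0 x) \<in> fe_space0 k \<T>"
    using 0(1) by (simp add: fe_space0_def continuous_on_mult_left)
  moreover have eq: "(\<lambda>x. c * v x) = (\<lambda>x. if x \<in> \<Union>(active_mesh \<Omega> \<T>) then c * v\<^sub>0 x else 0)"
    unfolding 0(2) by (rule ext) simp
  ultimately show ?thesis
    unfolding fe_space_def eq by (intro imageI)
qed

lemma fe_space_diff:
  assumes "v \<in> fe_space k \<Omega> \<T>" "w \<in> fe_space k \<Omega> \<T>"
  shows "(\<lambda>x. v x - w x) \<in> fe_space k \<Omega> \<T>"
  using fe_space_add[OF assms(1) fe_space_scale[OF assms(2), of "-1"]] by simp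

lemma zero_in_fe_space: "(\<lambda>x. 0) \<in> fe_space k \<Omega> \<T>"
proof -
  have "(\<lambda>x. 0) \<in> fe_space0 k \<T>"
    unfolding fe_space0_def by (auto intro: bexI[of _ "\<lambda>x. 0"])
  then show ?thesis
    unfolding fe_space_def by (intro image_eqI[of _ _ "\<lambda>x. 0"]) auto
qed

lemma fe_space_sum:
  assumes "\<And>j. j \<in> J \<Longrightarrow> b j \<in> fe_space k \<Omega> \<T>"
  shows "(\<lambda>x. \<Sum>j\<in>J. a j * b j x) \<in> fe_space k \<Omega> \<T>"
  using assms
  by (induction J rule: infinite_finite_induct)
    (simp_all add: zero_in_fe_space fe_space_add fe_space_scale)

lemma fe_space_eq_0: "v \<in> fe_space k \<Omega> \<T> \<Longrightarrow> x \<notin> \<Union>(active_mesh \<Omega> \<T>) \<Longrightarrow> v x = 0"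
  by (elim fe_spaceE) simp

lemma fe_space_piece:
  assumes "v \<in> fe_space k \<Omega> \<T>" "T \<in> active_mesh \<Omega> \<T>"
  obtains p where "p \<in> polys k" "\<And>x. x \<in> T \<Longrightarrow> v x = p x"
proof -
  obtain v\<^sub>0 where
    0: "v\<^sub>0 \<in> fe_space0 k \<T>" "v = (\<lambda>x. if x \<in> \<Union>(active_mesh \<Omega> \<T>) then v\<^sub>0 x else 0)"
    using assms(1) by (rule fe_spaceE)
  have "T \<in> \<T>" using assms(2) by (simp add: active_mesh_def)
  then obtain p where "p \<in> polys k" "\<forall>x\<in>T. v\<^sub>0 x = p x"
    using 0(1) unfolding fe_space0_def by blast
  moreover have "v x = v\<^sub>0 x" if "x \<in> T" for x
    using that assms(2) 0(2) by auto
  ultimately show thesis using that by auto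
qed

lemma fe_space_continuous_on:
  assumes "v \<in> fe_space k \<Omega> \<T>"
  shows "continuous_on (\<Union>(active_mesh \<Omega> \<T>)) v"
proof -
  obtain v\<^sub>0 where
    0: "v\<^sub>0 \<in> fe_space0 k \<T>" "v = (\<lambda>x. if x \<in> \<Union>(active_mesh \<Omega> \<T>) then v\<^sub>0 x else 0)"
    using assms(1) by (rule fe_spaceE)
  have "continuous_on (\<Union>(active_mesh \<Omega> \<T>)) v\<^sub>0"
    using 0(1) by (rule_tac continuous_on_subset[of "\<Union>\<T>"]) (auto simp: fe_space0_def active_mesh_def)
  then show ?thesis
    unfolding 0(2) by (rule continuous_on_eq) simp
qed

text \<open>One mesh, at fixed \<open>h\<close>. The interior points of the elements will come from
  the inscribed balls of the quasiuniform family.\<close>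

locale nodal_fe =
  fixes k :: nat and \<Omega> :: "(real ^ 'n) set" and \<T> :: "(real ^ 'n) set set"
    and \<phi> :: "real ^ 'n \<Rightarrow> real ^ 'n \<Rightarrow> real"
  assumes degree: "k \<ge> 1"
    and finite_mesh: "finite \<T>"
    and simplex_mesh: "T \<in> \<T> \<Longrightarrow> int CARD('n) simplex T"
    and interior_mesh: "T \<in> \<T> \<Longrightarrow> interior T \<noteq> {}"
    and basis: "nodal_basis k \<Omega> \<T> \<phi>"
begin

abbreviation "V \<equiv> fe_space k \<Omega> \<T>"
abbreviation "\<A> \<equiv> active_mesh \<Omega> \<T>"
abbreviation "\<N> \<equiv> fe_nodes k \<Omega> \<T>"

lemma active_simplex: "T \<in> \<A> \<Longrightarrow> int CARD('n) simplex T"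
  and active_interior: "T \<in> \<A> \<Longrightarrow> interior T \<noteq> {}"
  and finite_active: "finite \<A>"
  using simplex_mesh interior_mesh finite_mesh by (simp_all add: active_mesh_def)

lemma active_convex: "T \<in> \<A> \<Longrightarrow> convex T"
  and active_compact: "T \<in> \<A> \<Longrightarrow> compact T"
  using active_simplex convex_simplex compact_simplex by blast+

lemma basis_in_V: "j \<in> \<N> \<Longrightarrow> \<phi> j \<in> V"
  and basis_nodal: "i \<in> \<N> \<Longrightarrow> j \<in> \<N> \<Longrightarrow> \<phi> i j = (if i = j then 1 else 0)"
  using basis by (auto simp: nodal_basis_def)

lemma nodes_subset: "T \<in> \<A> \<Longrightarrow> lagrange_nodes k T \<subseteq> \<N>"
  by (auto simp: fe_nodes_def)

lemma finite_nodes: "finite \<N>"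
  unfolding fe_nodes_def using finite_active finite_lagrange_nodes[OF active_simplex] by blast

section \<open>Canonical extension, element basis and degrees of freedom\<close>

lemma poly_ext_eq:
  assumes "T \<in> \<A>" "p \<in> polys k" "\<And>x. x \<in> T \<Longrightarrow> v x = p x"
  shows "poly_ext k T v = p"
  unfolding poly_ext_def
proof (rule the_equality)
  show "q = p" if "q \<in> polys k \<and> (\<forall>x\<in>T. q x = v x)" for q
    using that assms polys_eqI[OF _ assms(2) active_interior[OF assms(1)]] by simp
qed (use assms in auto)

lemma poly_ext_piece:
  assumes "v \<in> V" "T \<in> \<A>"
  shows "poly_ext k T v \<in> polys k" "x \<in> T \<Longrightarrow> poly_ext k T v x = v x"
  using assms poly_ext_eq by (metis fe_space_piece)+

lemma poly_ext_diff:
  assumes "v \<in> V" "w \<in> V" "T \<in> \<A>"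
  shows "poly_ext k T (\<lambda>x. v x - w x) = (\<lambda>x. poly_ext k T v x - poly_ext k T w x)"
  using assms poly_ext_piece by (intro poly_ext_eq polys_diff) auto

text \<open>Unisolvence on one element: the extended pieces of the basis functions are dual to the
  nodes of \<open>T\<close>, and these are at least as many as the monomials.\<close>

lemma element_expansion:
  assumes "T \<in> \<A>" "p \<in> polys k" "x \<in> T"
  shows "p x = (\<Sum>j\<in>lagrange_nodes k T. p j * \<phi> j x)"
proof -
  let ?L = "lagrange_nodes k T"
  have L: "?L \<subseteq> T" "?L \<subseteq> \<N>"
    using lagrange_nodes_subset[OF active_simplex[OF assms(1)] degree] nodes_subset[OF assms(1)] by auto
  then have P: "poly_ext k T (\<phi> j) \<in> polys k" "y \<in> T \<Longrightarrow> poly_ext k T (\<phi> j) y = \<phi> j y"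
    if "j \<in> ?L" for j y
    using that poly_ext_piece[OF basis_in_V assms(1)] by blast+
  have "p x = (\<Sum>j\<in>?L. p j * poly_ext k T (\<phi> j) x)"
  proof (rule polys_nodal_expansion[where k = k])
    show "poly_ext k T (\<phi> i) j = (if i = j then 1 else 0)" if "i \<in> ?L" "j \<in> ?L" for i j
      using that L P basis_nodal[of i j] by (simp add: subset_iff)
  qed (use assms P finite_lagrange_nodes[OF active_simplex[OF assms(1)]]
    card_lagrange_nodes_ge[OF active_simplex[OF assms(1)] degree] in auto)
  then show ?thesis using P assms(3) by simp
qed

text \<open>On \<open>T\<close> the function \<open>\<phi> j\<close> is determined by its values at
  the nodes of \<open>T\<close>, and these are all 0.\<close>

lemma basis_eq_0:
  assumes "T \<in> \<A>" "j \<in> \<N>" "j \<notin> lagrange_nodes k T" "x \<in> T"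
  shows "\<phi> j x = 0"
proof -
  have "\<phi> j x = poly_ext k T (\<phi> j) x"
    using poly_ext_piece(2)[OF basis_in_V assms(1,4)] assms(2) by simp
  also have "\<dots> = (\<Sum>i\<in>lagrange_nodes k T. poly_ext k T (\<phi> j) i * \<phi> i x)"
    using element_expansion poly_ext_piece(1)[OF basis_in_V] assms by blast
  also have "\<dots> = 0"
  proof (rule sum.neutral, rule ballI)
    fix i assume i: "i \<in> lagrange_nodes k T"
    then have "i \<in> T" "i \<in> \<N>" "i \<noteq> j"
      using lagrange_nodes_subset[OF active_simplex[OF assms(1)] degree] nodes_subset[OF assms(1)] assms(3)
      by auto
    then show "poly_ext k T (\<phi> j) i * \<phi> i x = 0"
      using poly_ext_piece(2)[OF basis_in_V assms(1)] basis_nodal assms(2) by simp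
  qed
  finally show ?thesis .
qed

text \<open>Identifies the index set of the sum in \<open>elem_dof\<close> with the nodes of
  \<open>T\<close>. From right to left, the piece of \<open>\<phi> j\<close> on \<open>T\<close> is
  1 at \<open>j\<close>, so it vanishes on no nonempty open set; its nonzero points are therefore
  dense in \<open>interior T\<close>, whose closure contains \<open>T\<close>.\<close>

lemma subset_supp_iff:
  assumes T: "T \<in> \<A>" and j: "j \<in> \<N>"
  shows "T \<subseteq> supp (\<phi> j) \<longleftrightarrow> j \<in> lagrange_nodes k T"
proof
  assume sub: "T \<subseteq> supp (\<phi> j)"
  show "j \<in> lagrange_nodes k T"
  proof (rule ccontr)
    assume "j \<notin> lagrange_nodes k T"
    then have "interior T \<inter> {x. \<phi> j x \<noteq> 0} = {}"
      using basis_eq_0[OF T j] interior_subset by fastforce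
    then have "interior T \<inter> supp (\<phi> j) = {}"
      unfolding supp_def by (simp add: open_Int_closure_eq_empty)
    then show False using sub interior_subset active_interior[OF T] by fast
  qed
next
  assume j_node: "j \<in> lagrange_nodes k T"
  define p where "p = poly_ext k T (\<phi> j)"
  have p: "p \<in> polys k" "\<And>x. x \<in> T \<Longrightarrow> p x = \<phi> j x"
    unfolding p_def using poly_ext_piece[OF basis_in_V[OF j] T] by auto
  have "j \<in> T"
    using j_node lagrange_nodes_subset[OF active_simplex[OF T] degree] by auto
  then have "p j = 1" using p(2) basis_nodal[OF j j] by simp
  show "T \<subseteq> supp (\<phi> j)"
  proof
    fix y assume "y \<in> T"
    then have y: "y \<in> closure (interior T)"
      using convex_closure_interior[OF active_convex[OF T] active_interior[OF T]]
        closure_subset by auto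
    show "y \<in> supp (\<phi> j)"
      unfolding supp_def closure_iff_nhds_not_empty
    proof (intro allI impI)
      fix A U assume U: "U \<subseteq> A" "open U" "y \<in> U"
      then have "U \<inter> interior T \<noteq> {}"
        using y unfolding closure_iff_nhds_not_empty by blast
      then have ne: "interior (U \<inter> interior T) \<noteq> {}"
        using U(2) by (simp add: interior_open)
      have "\<exists>x \<in> U \<inter> interior T. p x \<noteq> 0"
        using polys_eqI[OF p(1) polys_zero ne] \<open>p j = 1\<close> by fastforce
      then show "{x. \<phi> j x \<noteq> 0} \<inter> A \<noteq> {}"
        using U(1) p(2) interior_subset by fastforce
    qed
  qed
qed

text \<open>Evaluating an element expansion at the node \<open>i\<close> leaves only the coefficient
  of \<open>\<phi> i\<close>, which settles the definite description. Asking \<open>q\<close> to be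
  polynomial on \<open>T\<close> alone admits finite element functions as well as
  extensions.\<close>

lemma elem_dof_eq:
  assumes T: "T \<in> \<A>" and i: "i \<in> lagrange_nodes k T"
    and p: "p \<in> polys k" "\<And>x. x \<in> T \<Longrightarrow> q x = p x"
  shows "elem_dof k \<Omega> \<T> \<phi> i T q = q i"
proof -
  have J: "{j. j \<in> \<N> \<and> T \<subseteq> supp (\<phi> j)} = lagrange_nodes k T"
    using subset_supp_iff[OF T] nodes_subset[OF T] by auto
  have "i \<in> T"
    using i lagrange_nodes_subset[OF active_simplex[OF T] degree] by auto
  show ?thesis
    unfolding elem_dof_def J
  proof (rule the_equality)
    show "\<exists>a. a i = q i \<and> (\<forall>x\<in>T. q x = (\<Sum>j\<in>lagrange_nodes k T. a j * \<phi> j x))"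
      using element_expansion[OF T p(1)] p(2) \<open>i \<in> T\<close> by (intro exI[of _ p]) simp
  next
    fix c assume "\<exists>a. a i = c \<and> (\<forall>x\<in>T. q x = (\<Sum>j\<in>lagrange_nodes k T. a j * \<phi> j x))"
    then obtain a where a: "a i = c" "q i = (\<Sum>j\<in>lagrange_nodes k T. a j * \<phi> j i)"
      using \<open>i \<in> T\<close> by blast
    have "(\<Sum>j\<in>lagrange_nodes k T. a j * \<phi> j i) = (\<Sum>j\<in>lagrange_nodes k T. if j = i then a j else 0)"
      using basis_nodal nodes_subset[OF T] i by (intro sum.cong) (auto simp: subset_iff)
    then show "c = q i"
      using a i finite_lagrange_nodes[OF active_simplex[OF T]] by simp
  qed
qed

text \<open>The expansion on one element containing \<open>x\<close> already has every nonzero term,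
  as the other basis functions vanish there. Off the active mesh both sides are 0 through the
  extension by zero.\<close>

lemma nodal_expansion:
  assumes "v \<in> V"
  shows "v x = (\<Sum>j\<in>\<N>. v j * \<phi> j x)"
proof (cases "x \<in> \<Union>\<A>")
  case False
  then show ?thesis
    using fe_space_eq_0 assms basis_in_V by (metis (no_types, lifting) mult_zero_right sum.neutral)
next
  case True
  then obtain T where T: "T \<in> \<A>" "x \<in> T" by blast
  let ?L = "lagrange_nodes k T"
  have "v x = poly_ext k T v x"
    using poly_ext_piece(2)[OF assms T] by simp
  also have "\<dots> = (\<Sum>j\<in>?L. poly_ext k T v j * \<phi> j x)"
    using element_expansion poly_ext_piece(1)[OF assms] T by blast
  also have "\<dots> = (\<Sum>j\<in>?L. v j * \<phi> j x)"
    using poly_ext_piece(2)[OF assms T(1)] lagrange_nodes_subset[OF active_simplex[OF T(1)] degree]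
    by (intro sum.cong) auto
  also have "\<dots> = (\<Sum>j\<in>\<N>. v j * \<phi> j x)"
    using nodes_subset[OF T(1)] finite_nodes basis_eq_0[OF T(1) _ _ T(2)]
    by (intro sum.mono_neutral_left) auto
  finally show ?thesis .
qed

end

section \<open>The extension operator and the stabilization form\<close>

locale cut_fe = nodal_fe k \<Omega> \<T> \<phi> for k \<Omega> and \<T> :: "(real ^ 'n) set set" and \<phi> +
  fixes \<gamma> :: real and S :: "(real ^ 'n) set \<Rightarrow> (real ^ 'n) set" and t :: "real ^ 'n \<Rightarrow> (real ^ 'n) set"
  assumes S: "S \<in> small_elems \<gamma> \<Omega> \<T> \<rightarrow> large_elems \<gamma> \<Omega> \<T>"
    and choice: "element_choice k \<gamma> \<Omega> \<T> \<phi> t"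
begin

abbreviation "I\<^sub>S \<equiv> small_nodes k \<gamma> \<Omega> \<T> \<phi>"
abbreviation "I\<^sub>L \<equiv> large_nodes k \<gamma> \<Omega> \<T> \<phi>"

definition jump_dof :: "real ^ 'n \<Rightarrow> (real ^ 'n \<Rightarrow> real) \<Rightarrow> real" where
  "jump_dof i v = elem_dof k \<Omega> \<T> \<phi> i (t i) (jump k (t i) (S (t i)) v)"

lemma small_node:
  assumes "i \<in> I\<^sub>S"
  shows "i \<in> \<N>" "t i \<in> \<A>" "i \<in> lagrange_nodes k (t i)" "i \<in> t i" "S (t i) \<in> \<A>"
proof -
  show N: "i \<in> \<N>" and T: "t i \<in> \<A>"
    using assms choice by (auto simp: small_nodes_def element_choice_def)
  have "t i \<subseteq> supp (\<phi> i)"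
    using assms choice by (auto simp: element_choice_def)
  then show L: "i \<in> lagrange_nodes k (t i)"
    using subset_supp_iff[OF T N] by simp
  then show "i \<in> t i"
    using lagrange_nodes_subset[OF active_simplex[OF T] degree] by blast
  \<comment> \<open>A large \<open>t i\<close> inside the support would make \<open>i\<close> a
    large node; so \<open>S\<close> is applied within its domain.\<close>
  have "t i \<in> small_elems \<gamma> \<Omega> \<T>"
    using T \<open>t i \<subseteq> supp (\<phi> i)\<close> assms by (auto simp: small_nodes_def small_elems_def)
  then have "S (t i) \<in> large_elems \<gamma> \<Omega> \<T>" using S by blast
  then show "S (t i) \<in> \<A>" by (simp add: large_elems_def)
qed

lemma large_node:
  assumes "i \<in> I\<^sub>L"
  shows "i \<in> \<N>" "t i \<in> \<A>" "i \<in> lagrange_nodes k (t i)"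
proof -
  show N: "i \<in> \<N>" and T: "t i \<in> \<A>"
    using assms choice by (auto simp: large_nodes_def element_choice_def large_elems_def)
  have "t i \<subseteq> supp (\<phi> i)"
    using assms choice by (auto simp: element_choice_def)
  then show "i \<in> lagrange_nodes k (t i)"
    using subset_supp_iff[OF T N] by simp
qed

text \<open>The node lies in \<open>t i\<close>, where the extension returns \<open>v\<close>, but
  perhaps not in \<open>S (t i)\<close>, so the second term remains an extrapolation.\<close>

lemma jump_dof_eq:
  assumes "i \<in> I\<^sub>S" "v \<in> V"
  shows "jump_dof i v = v i - poly_ext k (S (t i)) v i"
proof -
  note i = small_node[OF assms(1)]
  have "jump k (t i) (S (t i)) v \<in> polys k"
    unfolding jump_def using poly_ext_piece(1)[OF assms(2)] i by (intro polys_diff) auto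
  then have "jump_dof i v = jump k (t i) (S (t i)) v i"
    unfolding jump_dof_def using elem_dof_eq[OF i(2,3)] by blast
  then show ?thesis
    using poly_ext_piece(2)[OF assms(2) i(2,4)] by (simp add: jump_def)
qed

lemma jump_dof_diff:
  assumes "i \<in> I\<^sub>S" "v \<in> V" "w \<in> V"
  shows "jump_dof i (\<lambda>x. v x - w x) = jump_dof i v - jump_dof i w"
  using assms by (simp add: jump_dof_eq fe_space_diff poly_ext_diff small_node)

text \<open>At a large node both functions have the coefficient \<open>v i\<close>, and the terms
  cancel. At a small node the extrapolated value differs from \<open>v i\<close> by the jump degree
  of freedom.\<close>

lemma ext_op_error:
  assumes "v \<in> V"
  shows "v x - ext_op k \<gamma> \<Omega> \<T> \<phi> S t v x = (\<Sum>i\<in>I\<^sub>S. jump_dof i v * \<phi> i x)"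
proof -
  have small: "elem_dof k \<Omega> \<T> \<phi> i (t i) (poly_ext k (S (t i)) v) = v i - jump_dof i v" if "i \<in> I\<^sub>S" for i
    using elem_dof_eq[OF small_node(2,3)[OF that] poly_ext_piece(1)[OF assms small_node(5)[OF that]] refl]
      jump_dof_eq[OF that assms] by simp
  have large: "elem_dof k \<Omega> \<T> \<phi> i (t i) v = v i" if "i \<in> I\<^sub>L" for i
    using elem_dof_eq[OF large_node(2,3)[OF that] poly_ext_piece(1)[OF assms large_node(2)[OF that]]]
      poly_ext_piece(2)[OF assms large_node(2)[OF that]] by simp
  have IS: "I\<^sub>S \<subseteq> \<N>" and IL: "I\<^sub>L = \<N> - I\<^sub>S"
    by (auto simp: small_nodes_def large_nodes_def)
  have "v x = (\<Sum>i\<in>I\<^sub>L. v i * \<phi> i x) + (\<Sum>i\<in>I\<^sub>S. v i * \<phi> i x)"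
    using nodal_expansion[OF assms, of x] sum.subset_diff[OF IS finite_nodes] unfolding IL by simp
  moreover have "ext_op k \<gamma> \<Omega> \<T> \<phi> S t v x =
      (\<Sum>i\<in>I\<^sub>S. (v i - jump_dof i v) * \<phi> i x) + (\<Sum>i\<in>I\<^sub>L. v i * \<phi> i x)"
    unfolding ext_op_def using small large by simp
  ultimately show ?thesis
    by (simp add: left_diff_distrib sum_subtractf)
qed

lemma s_form_eq:
  "s_form k \<gamma> \<Omega> \<T> \<phi> S t h \<tau> v w =
     \<tau> * (h powi (int CARD('n) - 2) * (\<Sum>i\<in>I\<^sub>S. jump_dof i v * jump_dof i w))"
  unfolding s_form_def jump_dof_def by (simp add: sum_distrib_left mult.assoc)

end

section \<open>Products of bounded measurable functions\<close>

text \<open>A class whose products are integrable over sets of finite measure, which is what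
  bilinearity of \<open>l2_inner\<close> requires. The bound holds almost everywhere because
  gradients and normal derivatives are arbitrary on null sets.\<close>

definition bounded_measurable_on :: "'a measure \<Rightarrow> 'a set \<Rightarrow> ('a \<Rightarrow> 'b::euclidean_space) \<Rightarrow> bool" where
  "bounded_measurable_on M X F \<longleftrightarrow>
     set_borel_measurable M X F \<and> (\<exists>K. AE x in M. x \<in> X \<longrightarrow> norm (F x) \<le> K)"

lemma bounded_measurable_set_integrable:
  assumes X: "X \<in> sets M" "emeasure M X < \<infinity>"
    and "bounded_measurable_on M X F" "bounded_measurable_on M X G"
  shows "set_integrable M X (\<lambda>x. F x \<bullet> G x)"
proof -
  obtain K L where K: "AE x in M. x \<in> X \<longrightarrow> norm (F x) \<le> K" and L: "AE x in M. x \<in> X \<longrightarrow> norm (G x) \<le> L"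
    and [measurable]: "(\<lambda>x. indicator X x *\<^sub>R F x) \<in> borel_measurable M"
      "(\<lambda>x. indicator X x *\<^sub>R G x) \<in> borel_measurable M"
    using assms(3,4) unfolding bounded_measurable_on_def set_borel_measurable_def by blast
  \<comment> \<open>Each factor carries its own indicator, since measurability is known only for the
    cut-off functions.\<close>
  have "integrable M (\<lambda>x. indicator X x *\<^sub>R ((indicator X x *\<^sub>R F x) \<bullet> (indicator X x *\<^sub>R G x)))"
  proof (rule integrableI_bounded_set_indicator[OF X(1) _ X(2)])
    show "AE x in M. x \<in> X \<longrightarrow> norm ((indicator X x *\<^sub>R F x) \<bullet> (indicator X x *\<^sub>R G x)) \<le> K * L"
      using K L
    proof eventually_elim
      case (elim x)
      have "norm (F x \<bullet> G x) \<le> K * L" if "x \<in> X"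
        using that elim Cauchy_Schwarz_ineq2[of "F x" "G x"]
          mult_mono[of "norm (F x)" K "norm (G x)" L] order_trans[OF norm_ge_zero, of "F x" K] by auto
      then show ?case by simp
    qed
  qed measurable
  moreover have "(\<lambda>x. indicator X x *\<^sub>R ((indicator X x *\<^sub>R F x) \<bullet> (indicator X x *\<^sub>R G x))) =
      (\<lambda>x. indicator X x *\<^sub>R (F x \<bullet> G x))"
    by (auto simp: indicator_def)
  ultimately show ?thesis
    unfolding set_integrable_def by simp
qed

text \<open>Bilinearity with room for null sets: \<open>D\<close> and \<open>D'\<close> will be the
  gradient or normal derivative of a difference, which splits only almost everywhere.\<close>

lemma l2_inner_diff:
  assumes X: "X \<in> sets M" "emeasure M X < \<infinity>"
    and F: "bounded_measurable_on M X F" and F': "bounded_measurable_on M X F'"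
    and G: "bounded_measurable_on M X G" and G': "bounded_measurable_on M X G'"
    and D: "bounded_measurable_on M X D" and D': "bounded_measurable_on M X D'"
    and eq: "AE x in M. x \<in> X \<longrightarrow> D x = F x - G x" "AE x in M. x \<in> X \<longrightarrow> D' x = F' x - G' x"
  shows "l2_inner M X D D' = l2_inner M X F F' - l2_inner M X F G' - l2_inner M X G F' + l2_inner M X G G'"
proof -
  note int = bounded_measurable_set_integrable[OF X]
  note [simp] = int[OF F F'] int[OF F G'] int[OF G F'] int[OF G G']
  have int2: "set_integrable M X (\<lambda>x. F x \<bullet> F' x - F x \<bullet> G' x - G x \<bullet> F' x + G x \<bullet> G' x)"
    by (intro set_integral_add set_integral_diff) simp_all
  have "l2_inner M X D D' = (LINT x:X|M. F x \<bullet> F' x - F x \<bullet> G' x - G x \<bullet> F' x + G x \<bullet> G' x)"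
    unfolding l2_inner_def set_lebesgue_integral_def
  proof (rule integral_cong_AE)
    show "AE x in M. indicat_real X x *\<^sub>R (D x \<bullet> D' x) =
      indicat_real X x *\<^sub>R (F x \<bullet> F' x - F x \<bullet> G' x - G x \<bullet> F' x + G x \<bullet> G' x)"
      using eq by eventually_elim (auto simp: inner_diff_left inner_diff_right)
  qed (use int[OF D D'] int2 in \<open>auto simp: set_integrable_def\<close>)
  also have "\<dots> = l2_inner M X F F' - l2_inner M X F G' - l2_inner M X G F' + l2_inner M X G G'"
    unfolding l2_inner_def by (simp add: set_integral_add set_integral_diff)
  finally show ?thesis .
qed

lemma l2_inner_commute: "l2_inner M X F G = l2_inner M X G F"
  by (simp add: l2_inner_def inner_commute)

lemma l2_inner_nonneg: "l2_inner M X F F \<ge> 0"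
  unfolding l2_inner_def set_lebesgue_integral_def by (rule integral_nonneg_AE) simp

lemma l2_norm_sq: "(l2_norm M X F)\<^sup>2 = l2_inner M X F F"
  by (simp add: l2_norm_def l2_inner_nonneg)

text \<open>Integrates the pointwise square
  \<open>inverse c * (c * F x - G x)\<^sup>2\<close>.\<close>

lemma l2_inner_young:
  fixes F G :: "'a \<Rightarrow> real"
  assumes X: "X \<in> sets M" "emeasure M X < \<infinity>" and "c > 0"
    and F: "bounded_measurable_on M X F" and G: "bounded_measurable_on M X G"
  shows "2 * l2_inner M X F G \<le> c * l2_inner M X F F + inverse c * l2_inner M X G G"
proof -
  note int = bounded_measurable_set_integrable[OF X]
  note [simp] = int[OF F F, simplified] int[OF F G, simplified] int[OF G G, simplified]
  have int2: "set_integrable M X (\<lambda>x. c * (F x \<bullet> F x) - 2 * (F x \<bullet> G x) + inverse c * (G x \<bullet> G x))"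
    by (intro set_integral_add set_integral_diff set_integrable_mult_right) simp_all
  have "0 \<le> c * (F x \<bullet> F x) - 2 * (F x \<bullet> G x) + inverse c * (G x \<bullet> G x)" for x
  proof -
    have "c * (F x \<bullet> F x) - 2 * (F x \<bullet> G x) + inverse c * (G x \<bullet> G x) = inverse c * (c * F x - G x)\<^sup>2"
      using \<open>c > 0\<close> by (simp add: field_simps power2_eq_square)
    then show ?thesis using \<open>c > 0\<close> by simp
  qed
  then have "0 \<le> (LINT x:X|M. c * (F x \<bullet> F x) - 2 * (F x \<bullet> G x) + inverse c * (G x \<bullet> G x))"
    unfolding set_lebesgue_integral_def by (intro integral_nonneg_AE) simp
  also have "\<dots> = c * l2_inner M X F F - 2 * l2_inner M X F G + inverse c * l2_inner M X G G"
    unfolding l2_inner_def by (simp add: set_integral_add set_integral_diff)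
  finally show ?thesis by simp
qed

text \<open>By completeness, a set that agrees almost everywhere with a measurable one is
  measurable; this is applied to preimages. It carries measurability over to \<open>grad v\<close>
  and \<open>normal_deriv n v\<close>.\<close>

lemma borel_measurable_completion_AE:
  fixes f g :: "'a \<Rightarrow> 'b::topological_space"
  assumes "f \<in> borel_measurable (completion N)" "AE x in completion N. f x = g x"
  shows "g \<in> borel_measurable (completion N)"
proof (rule measurableI)
  fix A :: "'b set" assume "A \<in> sets borel"
  then have "f -` A \<inter> space (completion N) \<in> sets (completion N)"
    using assms(1) by (rule measurable_sets[rotated])
  moreover have "AE x in completion N. x \<in> f -` A \<inter> space (completion N) \<longleftrightarrow> x \<in> g -` A \<inter> space (completion N)"
    using assms(2) by eventually_elim auto
  ultimately show "g -` A \<inter> space (completion N) \<in> sets (completion N)"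
    using complete_measure.in_sets_AE[of "completion N"] completion.complete_measure_axioms by blast
qed simp

section \<open>Gradients and normal derivatives of finite element functions\<close>

lemma GDERIV_grad_eq: "GDERIV v x :> D \<Longrightarrow> grad v x = D"
  unfolding grad_def
proof (rule the_equality)
  show "D' = D" if "GDERIV v x :> D" "GDERIV v x :> D'" for D'
    using has_derivative_unique[OF that[unfolded gderiv_def]]
    by (metis vector_eq_ldot)
qed

lemma normal_deriv_eq:
  assumes "((\<lambda>s. v (x + s *\<^sub>R n x)) has_vector_derivative D) (at_left 0)"
  shows "normal_deriv n v x = D"
  unfolding normal_deriv_def by (rule vector_derivative_within[OF _ assms]) simp

locale fe_domain = nodal_fe k \<Omega> \<T> \<phi> for k \<Omega> and \<T> :: "(real ^ 'n) set set" and \<phi> +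
  fixes n :: "real ^ 'n \<Rightarrow> real ^ 'n"
  assumes closed: "closed \<Omega>" and covered: "\<Omega> \<subseteq> \<Union>\<T>" and boundary: "regular_boundary \<Omega> n"
begin

abbreviation "\<Gamma> \<equiv> frontier \<Omega>"

lemma domain_subset: "\<Omega> \<subseteq> \<Union>\<A>"
  using covered by (auto simp: active_mesh_def)

lemma boundary_subset: "\<Gamma> \<subseteq> \<Omega>"
  using closed by (rule frontier_subset_closed)

lemma domain_sets: "\<Omega> \<in> sets lebesgue"
  using closed by simp

text \<open>Boundedness of \<open>\<Omega>\<close> comes from its cover by finitely many compact
  simplices.\<close>

lemma domain_finite: "emeasure lebesgue \<Omega> < \<infinity>"
proof -
  have "compact (\<Union>\<A>)"
    using finite_active active_compact by (rule compact_Union)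
  then have "bounded \<Omega>"
    using domain_subset by (blast intro: compact_imp_bounded bounded_subset)
  then show ?thesis
    using closed emeasure_bounded_finite[of \<Omega>] by simp
qed

lemma boundary_sets: "\<Gamma> \<in> sets surface_measure"
  unfolding surface_measure_def by (intro sets_completionI_sets) simp

lemma boundary_finite: "emeasure surface_measure \<Gamma> < \<infinity>"
  using boundary by (simp add: regular_boundary_def)

text \<open>The sigma-algebra of \<open>measure_of\<close> depends on the generating sets alone, so
  Borel functions are measurable whatever the values of \<open>hausdorff_outer\<close>.\<close>

lemma borel_measurable_surface_measure:
  "f \<in> borel_measurable borel \<Longrightarrow> f \<in> borel_measurable (surface_measure :: (real ^ 'n) measure)"
  unfolding surface_measure_def by (intro measurable_completion) (simp add: measurable_def space_measure_of_conv)

lemma pieces: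
  assumes "v \<in> V"
  obtains p G K where "\<forall>T\<in>\<A>. (\<forall>x\<in>T. v x = p T x) \<and> (\<forall>x. GDERIV (p T) x :> G T x) \<and>
      continuous_on UNIV (G T) \<and> (\<forall>x\<in>T. norm (G T x) \<le> K)"
proof -
  have "\<exists>p G. (\<forall>x\<in>T. v x = p x) \<and> (\<forall>x. GDERIV p x :> G x) \<and> continuous_on UNIV G" if T: "T \<in> \<A>" for T
  proof -
    obtain p where p: "p \<in> polys k" "\<And>x. x \<in> T \<Longrightarrow> v x = p x"
      using assms T by (rule fe_space_piece) blast
    obtain G where "continuous_on UNIV G" "\<And>x. GDERIV p x :> G x"
      using real_polynomial_function_GDERIV[OF polys_real_polynomial_function[OF p(1)]] by blast
    with p show ?thesis by blast
  qed
  then obtain p G where pG: "\<forall>T\<in>\<A>. (\<forall>x\<in>T. v x = p T x) \<and> (\<forall>x. GDERIV (p T) x :> G T x) \<and> continuous_on UNIV (G T)"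
    by metis
  have "\<exists>B. \<forall>x\<in>T. norm (G T x) \<le> B" if "T \<in> \<A>" for T
  proof -
    have "bounded (G T ` T)"
      using pG that active_compact[OF that] continuous_on_subset[OF _ subset_UNIV]
      by (intro compact_imp_bounded compact_continuous_image) blast+
    then show ?thesis by (auto simp: bounded_iff)
  qed
  then obtain B where B: "\<forall>T\<in>\<A>. \<forall>x\<in>T. norm (G T x) \<le> B T" by metis
  \<comment> \<open>Summing over the finite mesh gives one bound for all elements.\<close>
  have "norm (G T x) \<le> (\<Sum>T\<in>\<A>. \<bar>B T\<bar>)" if "T \<in> \<A>" "x \<in> T" for T x
  proof -
    have "norm (G T x) \<le> \<bar>B T\<bar>" using B that by force
    also have "\<dots> \<le> (\<Sum>T\<in>\<A>. \<bar>B T\<bar>)"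
      using that finite_active by (intro member_le_sum) auto
    finally show ?thesis .
  qed
  with pG show thesis
    by (intro that[of p G "\<Sum>T\<in>\<A>. \<bar>B T\<bar>"]) auto
qed

text \<open>Frontiers of convex sets are negligible. Inside an element \<open>v\<close> is locally a
  polynomial, so \<open>grad\<close> is a true gradient there.\<close>

lemma AE_interior: "AE x in lebesgue. x \<in> \<Omega> \<longrightarrow> (\<exists>T\<in>\<A>. x \<in> interior T)"
proof -
  have "negligible (\<Union>T\<in>\<A>. frontier T)"
    using finite_active active_convex by (intro negligible_Union) (auto intro: negligible_convex_frontier)
  then have "(\<Union>T\<in>\<A>. frontier T) \<in> null_sets lebesgue"
    by (simp add: negligible_iff_null_sets)
  then have "AE x in lebesgue. x \<notin> (\<Union>T\<in>\<A>. frontier T)"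
    by (rule AE_not_in)
  then show ?thesis
  proof eventually_elim
    case (elim x)
    show ?case
    proof
      assume "x \<in> \<Omega>"
      then obtain T where "T \<in> \<A>" "x \<in> T" using domain_subset by blast
      then show "\<exists>T\<in>\<A>. x \<in> interior T"
        using elim closure_subset[of T] by (auto simp: frontier_def)
    qed
  qed
qed

lemma GDERIV_interior:
  assumes "T \<in> \<A>" "x \<in> interior T" "\<And>y. y \<in> T \<Longrightarrow> v y = p y" "GDERIV p x :> D"
  shows "GDERIV v x :> D"
  unfolding gderiv_def
  using has_derivative_transform_within_open[OF assms(4)[unfolded gderiv_def] open_interior assms(2)]
    assms(3) interior_subset[of T] by (metis subsetD)

lemma GDERIV_grad:
  assumes "v \<in> V" "T \<in> \<A>" "x \<in> interior T"
  shows "GDERIV v x :> grad v x"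
proof -
  obtain p G K where pGK: "\<forall>T\<in>\<A>. (\<forall>x\<in>T. v x = p T x) \<and> (\<forall>x. GDERIV (p T) x :> G T x) \<and>
      continuous_on UNIV (G T) \<and> (\<forall>x\<in>T. norm (G T x) \<le> K)"
    using assms(1) by (rule pieces)
  then have p: "v x = p T x" "GDERIV (p T) y :> G T y" "continuous_on UNIV (G T)" "norm (G T x) \<le> K"
    if "T \<in> \<A>" "x \<in> T" for T x y
    using that by auto
  have "GDERIV v x :> G T x"
    using GDERIV_interior[OF assms(2,3)] p(1,2)[OF assms(2)] assms(3) interior_subset by blast
  then show ?thesis by (simp add: GDERIV_grad_eq)
qed

lemma grad_diff_AE:
  assumes "v \<in> V" "w \<in> V"
  shows "AE x in lebesgue. x \<in> \<Omega> \<longrightarrow> grad (\<lambda>y. v y - w y) x = grad v x - grad w x"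
  using AE_interior by eventually_elim (auto intro!: GDERIV_grad_eq GDERIV_diff GDERIV_grad assms)

lemma grad_bounded_measurable:
  assumes "v \<in> V"
  shows "bounded_measurable_on lebesgue \<Omega> (grad v)"
proof -
  obtain p G K where pGK: "\<forall>T\<in>\<A>. (\<forall>x\<in>T. v x = p T x) \<and> (\<forall>x. GDERIV (p T) x :> G T x) \<and>
      continuous_on UNIV (G T) \<and> (\<forall>x\<in>T. norm (G T x) \<le> K)"
    using assms by (rule pieces)
  then have p: "v x = p T x" "GDERIV (p T) y :> G T y" "continuous_on UNIV (G T)" "norm (G T x) \<le> K"
    if "T \<in> \<A>" "x \<in> T" for T x y
    using that by auto
  have grad: "grad v x = G T x" if "T \<in> \<A>" "x \<in> interior T" for T x
    using GDERIV_grad_eq GDERIV_interior[OF that] p(1,2)[OF that(1)] that(2) interior_subset by blast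
  \<comment> \<open>Glues the continuous gradients of the pieces into one Borel function. Where
    interiors meet, the choice of piece is immaterial because each agrees with
    \<open>grad v\<close>.\<close>
  have "\<exists>H\<in>borel_measurable borel. \<forall>T\<in>B. \<forall>x\<in>interior T. grad v x = H x" if "B \<subseteq> \<A>" for B
    using finite_subset[OF that finite_active] that
  proof induction
    case empty
    then show ?case by (intro bexI[of _ "\<lambda>x. 0"]) auto
  next
    case (insert T B)
    then obtain H where [measurable]: "H \<in> borel_measurable borel"
      and H: "\<forall>T\<in>B. \<forall>x\<in>interior T. grad v x = H x" by auto
    have [measurable]: "G T \<in> borel_measurable borel"
      using insert.prems pGK by (intro borel_measurable_continuous_onI) auto
    have "(\<lambda>x. if x \<in> interior T then G T x else H x) \<in> borel_measurable borel"
      by measurable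
    moreover have "\<forall>T'\<in>insert T B. \<forall>x\<in>interior T'. grad v x = (if x \<in> interior T then G T x else H x)"
      using H insert.prems by (auto simp flip: grad)
    ultimately show ?case by (intro bexI[of _ "\<lambda>x. if x \<in> interior T then G T x else H x"])
  qed
  then obtain H where [measurable]: "H \<in> borel_measurable borel"
    and H: "\<forall>T\<in>\<A>. \<forall>x\<in>interior T. grad v x = H x" by blast
  have [measurable]: "\<Omega> \<in> sets borel" using closed by (rule borel_closed)
  have "(\<lambda>x. indicator \<Omega> x *\<^sub>R H x) \<in> borel_measurable lebesgue"
    by (intro measurable_completion) measurable
  moreover have "AE x in lebesgue. indicator \<Omega> x *\<^sub>R H x = indicator \<Omega> x *\<^sub>R grad v x"
    using AE_interior by eventually_elim (auto simp: H indicator_def)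
  ultimately have "set_borel_measurable lebesgue \<Omega> (grad v)"
    unfolding set_borel_measurable_def by (rule borel_measurable_completion_AE)
  moreover have "AE x in lebesgue. x \<in> \<Omega> \<longrightarrow> norm (grad v x) \<le> K"
    using AE_interior
  proof eventually_elim
    case (elim x)
    then show ?case using grad p(4) interior_subset by fastforce
  qed
  ultimately show ?thesis
    unfolding bounded_measurable_on_def by blast
qed

section \<open>Traces and one-sided normal derivatives\<close>

lemma borel_measurable_V:
  assumes "v \<in> V"
  shows "v \<in> borel_measurable borel"
proof -
  have "closed (\<Union>\<A>)"
    using finite_active active_compact by (intro compact_imp_closed compact_Union) auto
  then have "(\<lambda>x. if x \<in> \<Union>\<A> then v x else 0) \<in> borel_measurable borel"
    using fe_space_continuous_on[OF assms] by (intro borel_measurable_continuous_on_if) auto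
  also have "(\<lambda>x. if x \<in> \<Union>\<A> then v x else 0) = v"
    using fe_space_eq_0[OF assms] by auto
  finally show ?thesis .
qed

lemma trace_bounded_measurable:
  assumes "v \<in> V"
  shows "bounded_measurable_on surface_measure \<Gamma> v"
proof -
  have [measurable]: "v \<in> borel_measurable borel"
    by (rule borel_measurable_V[OF assms])
  have "(\<lambda>x. indicator \<Gamma> x *\<^sub>R v x) \<in> borel_measurable borel"
    by measurable
  then have "set_borel_measurable surface_measure \<Gamma> v"
    unfolding set_borel_measurable_def by (rule borel_measurable_surface_measure)
  moreover have "bounded (v ` (\<Union>\<A>))"
    using finite_active active_compact fe_space_continuous_on[OF assms]
    by (intro compact_imp_bounded compact_continuous_image compact_Union)
  then obtain K where "\<forall>x\<in>\<Union>\<A>. norm (v x) \<le> K"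
    by (auto simp: bounded_iff)
  then have "AE x in surface_measure. x \<in> \<Gamma> \<longrightarrow> norm (v x) \<le> K"
    using domain_subset boundary_subset by (intro AE_I2) auto
  ultimately show ?thesis
    unfolding bounded_measurable_on_def by blast
qed

text \<open>
  Along the inner half line the finitely many elements are met in intervals, so one of them contains
  an initial segment.
\<close>

lemma inner_segment:
  assumes "x \<in> \<Omega>" "outward_unit_normal \<Omega> x \<nu>"
  obtains T r where "T \<in> \<A>" "r > 0" "\<forall>s\<in>{- r..0}. x + s *\<^sub>R \<nu> \<in> T"
proof -
  have \<nu>: "norm \<nu> = 1" using assms(2) by (simp add: outward_unit_normal_def)
  \<comment> \<open>Any aperture below 1 would do, since
    \<open>(y - x) \<bullet> \<nu> = - norm (y - x)\<close> on the inner half line.\<close>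
  obtain r where r: "r > 0" "\<forall>y \<in> ball x r. (y - x) \<bullet> \<nu> < - (1/2) * norm (y - x) \<longrightarrow> y \<in> \<Omega>"
    using assms(2) unfolding outward_unit_normal_def by (meson half_gt_zero zero_less_one)
  have inside: "x + s *\<^sub>R \<nu> \<in> \<Omega>" if "- r < s" "s < 0" for s
  proof -
    have "(s *\<^sub>R \<nu>) \<bullet> \<nu> = s" using \<nu> by (simp add: dot_square_norm)
    then show ?thesis
      using that r(2)[rule_format, of "x + s *\<^sub>R \<nu>"] \<nu> by (simp add: dist_norm)
  qed
  have "\<exists>T\<in>\<A>. x + s *\<^sub>R \<nu> \<in> T" if "- r < s" "s < 0" for s
    using inside[OF that] domain_subset by blast
  then have ev: "eventually (\<lambda>s. \<exists>T\<in>\<A>. x + s *\<^sub>R \<nu> \<in> T) (at_left 0)"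
    unfolding eventually_at_left_field using r(1) by (intro exI[of _ "- r"]) simp
  \<comment> \<open>If each of the finitely many elements were eventually avoided, all of them would
    be avoided together close to \<open>x\<close>, against the cover.\<close>
  have "\<exists>T\<in>\<A>. \<exists>\<^sub>F s in at_left 0. x + s *\<^sub>R \<nu> \<in> T"
  proof (rule ccontr)
    assume "\<not> (\<exists>T\<in>\<A>. \<exists>\<^sub>F s in at_left 0. x + s *\<^sub>R \<nu> \<in> T)"
    then have "\<forall>T\<in>\<A>. eventually (\<lambda>s. x + s *\<^sub>R \<nu> \<notin> T) (at_left 0)"
      by (simp add: frequently_def)
    then have "eventually (\<lambda>s. \<forall>T\<in>\<A>. x + s *\<^sub>R \<nu> \<notin> T) (at_left 0)"
      using finite_active by (intro eventually_ball_finite)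
    with ev have "eventually (\<lambda>s. False) (at_left (0::real))"
      by eventually_elim blast
    then show False by simp
  qed
  then obtain T where T: "T \<in> \<A>" and freq: "\<exists>\<^sub>F s in at_left 0. x + s *\<^sub>R \<nu> \<in> T"
    by blast
  have ex: "\<exists>s\<in>{b<..<0}. x + s *\<^sub>R \<nu> \<in> T" if "b < 0" for b
    using freq that unfolding frequently_def eventually_at_left_field by (meson greaterThanLessThan_iff)
  obtain r' where r': "r' < 0" "x + r' *\<^sub>R \<nu> \<in> T" using ex[of "-1"] by auto
  \<comment> \<open>A parameter from \<open>r'\<close> on lies between \<open>r'\<close> and a later
    visit \<open>s'\<close> to \<open>T\<close>; convexity fills the gap.\<close>
  have seg: "x + s *\<^sub>R \<nu> \<in> T" if s: "r' \<le> s" "s < 0" for s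
  proof -
    obtain s' where s': "s < s'" "s' < 0" "x + s' *\<^sub>R \<nu> \<in> T" using ex[OF s(2)] by auto
    define u where "u = (s - r') / (s' - r')"
    have u: "0 \<le> u" "u \<le> 1" "u * (s' - r') = s - r'"
      using s s' by (auto simp: u_def divide_simps)
    have "(1 - u) *\<^sub>R (x + r' *\<^sub>R \<nu>) + u *\<^sub>R (x + s' *\<^sub>R \<nu>) \<in> T"
      using active_convex[OF T] r'(2) s'(3) u by (intro convexD_alt)
    also have "(1 - u) *\<^sub>R (x + r' *\<^sub>R \<nu>) + u *\<^sub>R (x + s' *\<^sub>R \<nu>) = x + (r' + u * (s' - r')) *\<^sub>R \<nu>"
      by (simp add: algebra_simps)
    finally show ?thesis using u(3) by simp
  qed
  \<comment> \<open>The endpoint is a limit of points of the closed set \<open>T\<close>. It matters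
    because the difference quotients also involve the value at \<open>x\<close>.\<close>
  have "x + 0 *\<^sub>R \<nu> \<in> T"
  proof (rule Lim_in_closed_set)
    show "closed T" using active_compact[OF T] by (rule compact_imp_closed)
    show "eventually (\<lambda>s. x + s *\<^sub>R \<nu> \<in> T) (at_left (0::real))"
      unfolding eventually_at_left_field using seg r'(1) by (intro exI[of _ r']) auto
    show "((\<lambda>s. x + s *\<^sub>R \<nu>) \<longlongrightarrow> x + 0 *\<^sub>R \<nu>) (at_left 0)"
      by (intro tendsto_intros)
  qed simp
  then have "x + s *\<^sub>R \<nu> \<in> T" if "r' \<le> s" "s \<le> 0" for s
    using seg[of s] that by (cases "s = 0") auto
  then show thesis using T r'(1) that[of T "- r'"] by simp
qed

lemma inner_derivative:
  assumes v: "v \<in> V"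
  obtains K where "\<forall>x\<in>\<Omega>. outward_unit_normal \<Omega> x (n x) \<longrightarrow>
      ((\<lambda>s. v (x + s *\<^sub>R n x)) has_vector_derivative normal_deriv n v x) (at_left 0) \<and>
      norm (normal_deriv n v x) \<le> K"
proof -
  obtain p G K where pGK: "\<forall>T\<in>\<A>. (\<forall>x\<in>T. v x = p T x) \<and> (\<forall>x. GDERIV (p T) x :> G T x) \<and>
      continuous_on UNIV (G T) \<and> (\<forall>x\<in>T. norm (G T x) \<le> K)"
    using assms by (rule pieces)
  then have p: "v x = p T x" "GDERIV (p T) y :> G T y" "continuous_on UNIV (G T)" "norm (G T x) \<le> K"
    if "T \<in> \<A>" "x \<in> T" for T x y
    using that by auto
  show thesis
  proof (rule that, intro ballI impI)
    fix x assume x: "x \<in> \<Omega>" "outward_unit_normal \<Omega> x (n x)"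
    obtain T r where T: "T \<in> \<A>" "r > 0" "\<forall>s\<in>{- r..0}. x + s *\<^sub>R n x \<in> T"
      using x by (rule inner_segment)
    have "x \<in> T" using T(2) T(3)[rule_format, of 0] by simp
    have "((\<lambda>s. p T (x + s *\<^sub>R n x)) has_derivative (\<lambda>s. (s *\<^sub>R n x) \<bullet> G T x)) (at 0)"
    proof (rule has_derivative_compose[where f = "\<lambda>s. x + s *\<^sub>R n x" and g = "p T" and g' = "\<lambda>h. h \<bullet> G T x"])
      show "((\<lambda>s. x + s *\<^sub>R n x) has_derivative (\<lambda>s. s *\<^sub>R n x)) (at 0)"
        by (auto intro!: derivative_eq_intros)
      show "(p T has_derivative (\<lambda>h. h \<bullet> G T x)) (at (x + 0 *\<^sub>R n x))"
        using p(2)[OF T(1) \<open>x \<in> T\<close>] by (simp add: gderiv_def)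
    qed
    then have "((\<lambda>s. p T (x + s *\<^sub>R n x)) has_vector_derivative n x \<bullet> G T x) (at 0)"
      by (simp add: has_vector_derivative_def)
    then have "((\<lambda>s. p T (x + s *\<^sub>R n x)) has_real_derivative n x \<bullet> G T x) (at_left 0)"
      by (simp add: has_real_derivative_iff_has_vector_derivative has_vector_derivative_at_within)
    then have "((\<lambda>s. (p T (x + s *\<^sub>R n x) - p T (x + 0 *\<^sub>R n x)) / (s - 0)) \<longlongrightarrow> n x \<bullet> G T x) (at_left 0)"
      by (simp add: has_field_derivative_iff)
    \<comment> \<open>A left derivative sees only the base point and parameters below 0, and there
      \<open>v\<close> is the polynomial piece on \<open>T\<close>.\<close>
    moreover have "eventually (\<lambda>s. (p T (x + s *\<^sub>R n x) - p T (x + 0 *\<^sub>R n x)) / (s - 0) =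
        (v (x + s *\<^sub>R n x) - v (x + 0 *\<^sub>R n x)) / (s - 0)) (at_left 0)"
      unfolding eventually_at_left_field using T p(1)[OF T(1)] \<open>x \<in> T\<close>
      by (intro exI[of _ "- r"]) simp
    ultimately have "((\<lambda>s. (v (x + s *\<^sub>R n x) - v (x + 0 *\<^sub>R n x)) / (s - 0)) \<longlongrightarrow> n x \<bullet> G T x) (at_left 0)"
      by (rule Lim_transform_eventually)
    then have D: "((\<lambda>s. v (x + s *\<^sub>R n x)) has_vector_derivative n x \<bullet> G T x) (at_left 0)"
      by (simp add: has_field_derivative_iff flip: has_real_derivative_iff_has_vector_derivative)
    have "norm (n x \<bullet> G T x) \<le> K"
      using Cauchy_Schwarz_ineq2[of "n x" "G T x"] p(4)[OF T(1) \<open>x \<in> T\<close>] x(2) order_trans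
      by (fastforce simp: outward_unit_normal_def)
    then show "((\<lambda>s. v (x + s *\<^sub>R n x)) has_vector_derivative normal_deriv n v x) (at_left 0) \<and>
        norm (normal_deriv n v x) \<le> K"
      using D normal_deriv_eq[of v x n, OF D] by simp
  qed
qed

lemma AE_normal: "AE x in surface_measure. x \<in> \<Gamma> \<longrightarrow> x \<in> \<Omega> \<and> outward_unit_normal \<Omega> x (n x)"
  using boundary boundary_subset unfolding regular_boundary_def by auto

lemma normal_deriv_diff_AE:
  assumes "v \<in> V" "w \<in> V"
  shows "AE x in surface_measure. x \<in> \<Gamma> \<longrightarrow> normal_deriv n (\<lambda>y. v y - w y) x = normal_deriv n v x - normal_deriv n w x"
  using AE_normal
proof eventually_elim
  case (elim x)
  show ?case
  proof
    assume "x \<in> \<Gamma>"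
    then have x: "x \<in> \<Omega>" "outward_unit_normal \<Omega> x (n x)" using elim by auto
    have "((\<lambda>s. v (x + s *\<^sub>R n x)) has_vector_derivative normal_deriv n v x) (at_left 0)"
      "((\<lambda>s. w (x + s *\<^sub>R n x)) has_vector_derivative normal_deriv n w x) (at_left 0)"
      by (rule inner_derivative[OF assms(1)], use x in blast) (rule inner_derivative[OF assms(2)], use x in blast)
    then show "normal_deriv n (\<lambda>y. v y - w y) x = normal_deriv n v x - normal_deriv n w x"
      by (intro normal_deriv_eq has_vector_derivative_diff)
  qed
qed

text \<open>Almost everywhere on the boundary the inner derivative is the limit of the difference
  quotients at \<open>s j\<close>, and these are measurable functions of \<open>x\<close>.\<close>

lemma normal_deriv_bounded_measurable:
  assumes "v \<in> V"
  shows "bounded_measurable_on surface_measure \<Gamma> (normal_deriv n v)"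
proof -
  obtain K where K: "\<forall>x\<in>\<Omega>. outward_unit_normal \<Omega> x (n x) \<longrightarrow>
      ((\<lambda>s. v (x + s *\<^sub>R n x)) has_vector_derivative normal_deriv n v x) (at_left 0) \<and>
      norm (normal_deriv n v x) \<le> K"
    using assms by (rule inner_derivative)
  define s :: "nat \<Rightarrow> real" where "s j = - inverse (real (Suc j))" for j
  have s: "filterlim s (at_left 0) sequentially"
    unfolding s_def filterlim_at using tendsto_minus[OF LIMSEQ_inverse_real_of_nat] by auto
  \<comment> \<open>\<open>n\<close> is known to be measurable only on \<open>\<Gamma>\<close>.
    Setting it to 0 elsewhere makes the shifted point in \<open>Q\<close> measurable on the whole
    space.\<close>
  define n' where "n' x = indicator \<Gamma> x *\<^sub>R n x" for x
  have [measurable]: "n' \<in> borel_measurable surface_measure"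
    using boundary unfolding regular_boundary_def set_borel_measurable_def n'_def by blast
  have [measurable]: "v \<in> borel_measurable borel" "v \<in> borel_measurable surface_measure"
    "(\<lambda>x. x) \<in> borel_measurable (surface_measure :: (real ^ 'n) measure)" "\<Gamma> \<in> sets surface_measure"
    using borel_measurable_V[OF assms] boundary_sets
    by (auto intro: borel_measurable_surface_measure[of v] borel_measurable_surface_measure[of "\<lambda>x. x"])
  define Q where "Q j x = (v (x + s j *\<^sub>R n' x) - v x) / s j" for j x
  have [measurable]: "Q j \<in> borel_measurable surface_measure" for j
    unfolding Q_def by measurable
  have "(\<lambda>x. indicator \<Gamma> x *\<^sub>R lim (\<lambda>j. Q j x)) \<in> borel_measurable surface_measure"
    by measurable
  moreover have "AE x in surface_measure. indicator \<Gamma> x *\<^sub>R lim (\<lambda>j. Q j x) = indicator \<Gamma> x *\<^sub>R normal_deriv n v x"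
    using AE_normal
  proof eventually_elim
    case (elim x)
    have "lim (\<lambda>j. Q j x) = normal_deriv n v x" if "x \<in> \<Gamma>"
    proof -
      have "((\<lambda>s. (v (x + s *\<^sub>R n x) - v x) / s) \<longlongrightarrow> normal_deriv n v x) (at_left 0)"
        using K elim that by (simp add: has_field_derivative_iff flip: has_real_derivative_iff_has_vector_derivative)
      from filterlim_compose[OF this s] have "(\<lambda>j. Q j x) \<longlonglongrightarrow> normal_deriv n v x"
        using that by (simp add: Q_def n'_def)
      then show ?thesis by (rule limI)
    qed
    then show ?case by (simp add: indicator_def)
  qed
  ultimately have "set_borel_measurable surface_measure \<Gamma> (normal_deriv n v)"
    unfolding set_borel_measurable_def surface_measure_def by (rule borel_measurable_completion_AE)
  moreover have "AE x in surface_measure. x \<in> \<Gamma> \<longrightarrow> norm (normal_deriv n v x) \<le> K"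
    using AE_normal by eventually_elim (use K in blast)
  ultimately show ?thesis
    unfolding bounded_measurable_on_def by blast
qed

end

section \<open>The limit of the discrete solutions\<close>

locale cut_method = cut_fe k \<Omega> \<T> \<phi> \<gamma> S t + fe_domain k \<Omega> \<T> \<phi> n
  for k \<Omega> and \<T> :: "(real ^ 'n) set set" and \<phi> \<gamma> S t n
begin

text \<open>The two mixed terms merge because \<open>a_form\<close> is symmetric: exchanging its
  arguments exchanges the two normal derivative terms.\<close>

lemma a_form_diff:
  assumes v: "v \<in> V" and w: "w \<in> V"
  shows "a_form \<Omega> n \<beta> h (\<lambda>x. v x - w x) (\<lambda>x. v x - w x) =
    a_form \<Omega> n \<beta> h v v - 2 * a_form \<Omega> n \<beta> h w v + a_form \<Omega> n \<beta> h w w"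
proof -
  let ?d = "\<lambda>x. v x - w x"
  let ?nd = "normal_deriv n"
  have d: "?d \<in> V" using v w by (rule fe_space_diff)
  note bm = grad_bounded_measurable trace_bounded_measurable normal_deriv_bounded_measurable
  have 1: "l2_inner lebesgue \<Omega> (grad ?d) (grad ?d) = l2_inner lebesgue \<Omega> (grad v) (grad v)
      - l2_inner lebesgue \<Omega> (grad v) (grad w) - l2_inner lebesgue \<Omega> (grad w) (grad v)
      + l2_inner lebesgue \<Omega> (grad w) (grad w)"
    by (rule l2_inner_diff[OF domain_sets domain_finite])
      (intro bm v w d grad_diff_AE[OF v w])+
  have 2: "l2_inner surface_measure \<Gamma> (?nd ?d) ?d = l2_inner surface_measure \<Gamma> (?nd v) v
      - l2_inner surface_measure \<Gamma> (?nd v) w - l2_inner surface_measure \<Gamma> (?nd w) v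
      + l2_inner surface_measure \<Gamma> (?nd w) w"
    by (rule l2_inner_diff[OF boundary_sets boundary_finite])
      (intro bm v w d normal_deriv_diff_AE[OF v w] AE_I2 impI refl)+
  have 3: "l2_inner surface_measure \<Gamma> ?d ?d = l2_inner surface_measure \<Gamma> v v
      - l2_inner surface_measure \<Gamma> v w - l2_inner surface_measure \<Gamma> w v
      + l2_inner surface_measure \<Gamma> w w"
    by (rule l2_inner_diff[OF boundary_sets boundary_finite])
      (intro bm v w d AE_I2 impI refl)+
  have c: "l2_inner lebesgue \<Omega> (grad v) (grad w) = l2_inner lebesgue \<Omega> (grad w) (grad v)"
    "l2_inner surface_measure \<Gamma> v w = l2_inner surface_measure \<Gamma> w v"
    "l2_inner surface_measure \<Gamma> x (?nd y) = l2_inner surface_measure \<Gamma> (?nd y) x" for x y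
    by (rule l2_inner_commute)+
  show ?thesis
    unfolding a_form_def c 1 2 3 by (simp add: algebra_simps)
qed

text \<open>Young's inequality with weight \<open>h / C\<close> on the normal derivative makes the
  inverse inequality absorb that term with constant exactly 1. The price is \<open>C / h\<close> on
  the trace, covered by the penalty when \<open>\<beta> \<ge> C\<close>.\<close>

lemma form_nonneg:
  assumes v: "v \<in> V" and "h > 0" "C > 0" "\<beta> \<ge> C"
    and inverse: "h * (l2_norm surface_measure \<Gamma> (normal_deriv n v))\<^sup>2
      \<le> C * ((l2_norm lebesgue \<Omega> (grad v))\<^sup>2 + s_form k \<gamma> \<Omega> \<T> \<phi> S t h \<tau> v v)"
  shows "0 \<le> a_form \<Omega> n \<beta> h v v + s_form k \<gamma> \<Omega> \<T> \<phi> S t h \<tau> v v"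
proof -
  define N where "N = l2_inner surface_measure \<Gamma> (normal_deriv n v) (normal_deriv n v)"
  define B where "B = l2_inner surface_measure \<Gamma> v v"
  have "B \<ge> 0" unfolding B_def by (rule l2_inner_nonneg)
  have "2 * l2_inner surface_measure \<Gamma> (normal_deriv n v) v \<le> h / C * N + inverse (h / C) * B"
    unfolding N_def B_def using assms(2,3)
    by (intro l2_inner_young boundary_sets boundary_finite normal_deriv_bounded_measurable
        trace_bounded_measurable v) simp
  also have "h / C * N \<le> (l2_norm lebesgue \<Omega> (grad v))\<^sup>2 + s_form k \<gamma> \<Omega> \<T> \<phi> S t h \<tau> v v"
    using inverse \<open>C > 0\<close> unfolding l2_norm_sq N_def by (simp add: field_simps)
  also have "inverse (h / C) * B \<le> \<beta> * inverse h * B"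
    using assms(2-4) \<open>B \<ge> 0\<close> by (intro mult_right_mono) (auto simp: field_simps)
  finally show ?thesis
    unfolding a_form_def l2_norm_sq B_def
    using l2_inner_commute[of surface_measure \<Gamma> v "normal_deriv n v"] by simp
qed

text \<open>
  The solution for one parameter \<open>\<tau>\<^sub>1\<close> represents the right hand side as a combination of the two
  forms, so no bound on \<open>f\<close> enters.
\<close>

lemma stabilization_tendsto_zero:
  fixes u :: "real \<Rightarrow> real ^ 'n \<Rightarrow> real"
  assumes "h > 0"
    and nonneg: "\<And>v. v \<in> V \<Longrightarrow> 0 \<le> a_form \<Omega> n \<beta> h v v + s_form k \<gamma> \<Omega> \<T> \<phi> S t h \<tau>\<^sub>s v v"
    and sol: "\<And>\<tau>. \<tau> \<ge> \<tau>\<^sub>0 \<Longrightarrow> discrete_solution k \<gamma> \<Omega> n \<T> \<phi> S t \<beta> h \<tau> f (u \<tau>)"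
  shows "((\<lambda>\<tau>. \<Sum>i\<in>I\<^sub>S. (jump_dof i (u \<tau>))\<^sup>2) \<longlongrightarrow> 0) at_top"
proof -
  define q where "q = h powi (int CARD('n) - 2)"
  have "q > 0" using \<open>h > 0\<close> by (simp add: q_def)
  define \<sigma> where "\<sigma> v w = q * (\<Sum>i\<in>I\<^sub>S. jump_dof i v * jump_dof i w)" for v w
  have s: "s_form k \<gamma> \<Omega> \<T> \<phi> S t h \<tau> v w = \<tau> * \<sigma> v w" for \<tau> v w
    by (simp add: s_form_eq \<sigma>_def q_def)
  have \<sigma>_nonneg: "\<sigma> v v \<ge> 0" for v
    unfolding \<sigma>_def using \<open>q > 0\<close> by (simp add: sum_nonneg)
  have \<sigma>_diff: "\<sigma> (\<lambda>x. v x - w x) (\<lambda>x. v x - w x) = \<sigma> v v - 2 * \<sigma> w v + \<sigma> w w"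
    if "v \<in> V" "w \<in> V" for v w
    unfolding \<sigma>_def using that
    by (simp add: jump_dof_diff algebra_simps sum.distrib sum_subtractf sum_distrib_left)
  let ?a = "a_form \<Omega> n \<beta> h"
  have uV: "u \<tau> \<in> V" if "\<tau> \<ge> \<tau>\<^sub>0" for \<tau>
    using sol[OF that] by (simp add: discrete_solution_def)
  \<comment> \<open>Solutions are available from \<open>\<tau>\<^sub>0\<close> on, and from
    \<open>\<tau>\<^sub>s\<close> on the form stays semidefinite because \<open>\<sigma>\<close> is
    nonnegative; \<open>\<tau>\<^sub>1\<close> meets both demands.\<close>
  define \<tau>\<^sub>1 where "\<tau>\<^sub>1 = max \<tau>\<^sub>0 \<tau>\<^sub>s"
  define w where "w = u \<tau>\<^sub>1"
  have w: "w \<in> V" unfolding w_def \<tau>\<^sub>1_def by (rule uV) simp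
  define C where "C = ?a w w + \<tau>\<^sub>1 * \<sigma> w w"
  \<comment> \<open>Let \<open>B\<close> be the form at \<open>\<tau>\<^sub>1\<close>. The two
    equations tested with \<open>u\<close> give
    \<open>B(w, u) = B(u, u) + (\<tau> - \<tau>\<^sub>1) \<sigma>(u, u)\<close>. Inserted into
    \<open>B(u - w, u - w) \<ge> 0\<close> this yields
    \<open>B(u, u) + 2 (\<tau> - \<tau>\<^sub>1) \<sigma>(u, u) \<le> C\<close>. The facts on
    \<open>u\<close> alone say
    \<open>B(u, u) + (\<tau> - \<tau>\<^sub>1) \<sigma>(u, u) \<ge> 0\<close>, which leaves the
    claim.\<close>
  have bound: "(\<tau> - \<tau>\<^sub>1) * \<sigma> (u \<tau>) (u \<tau>) \<le> C" if "\<tau> \<ge> \<tau>\<^sub>1" for \<tau>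
  proof -
    have u: "u \<tau> \<in> V" using that by (intro uV) (simp add: \<tau>\<^sub>1_def)
    note d = fe_space_diff[OF u w]
    have "?a (u \<tau>) (u \<tau>) + \<tau> * \<sigma> (u \<tau>) (u \<tau>) = ?a w (u \<tau>) + \<tau>\<^sub>1 * \<sigma> w (u \<tau>)"
      using sol[of \<tau>] sol[of \<tau>\<^sub>1] u that unfolding discrete_solution_def s w_def by (simp add: \<tau>\<^sub>1_def)
    moreover have "0 \<le> ?a (u \<tau>) (u \<tau>) - 2 * ?a w (u \<tau>) + ?a w w
        + \<tau>\<^sub>s * (\<sigma> (u \<tau>) (u \<tau>) - 2 * \<sigma> w (u \<tau>) + \<sigma> w w)"
      using nonneg[OF d] unfolding s a_form_diff[OF u w] \<sigma>_diff[OF u w] .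
    moreover have "0 \<le> ?a (u \<tau>) (u \<tau>) + \<tau>\<^sub>s * \<sigma> (u \<tau>) (u \<tau>)"
      using nonneg[OF u] unfolding s .
    moreover have "0 \<le> (\<tau>\<^sub>1 - \<tau>\<^sub>s) * (\<sigma> (u \<tau>) (u \<tau>) - 2 * \<sigma> w (u \<tau>) + \<sigma> w w)"
      using \<sigma>_nonneg \<sigma>_diff[OF u w] by (metis \<tau>\<^sub>1_def diff_ge_0_iff_ge max.cobounded2 mult_nonneg_nonneg)
    moreover have "0 \<le> (\<tau> - \<tau>\<^sub>s) * \<sigma> (u \<tau>) (u \<tau>)"
      using that \<sigma>_nonneg by (simp add: \<tau>\<^sub>1_def)
    ultimately show ?thesis
      unfolding C_def by (simp add: algebra_simps)
  qed
  have "((\<lambda>\<tau>. \<sigma> (u \<tau>) (u \<tau>)) \<longlongrightarrow> 0) at_top"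
  proof (rule tendsto_sandwich[where f = "\<lambda>_. 0" and h = "\<lambda>\<tau>. C / (\<tau> - \<tau>\<^sub>1)"])
    show "\<forall>\<^sub>F \<tau> in at_top. \<sigma> (u \<tau>) (u \<tau>) \<le> C / (\<tau> - \<tau>\<^sub>1)"
      using eventually_gt_at_top[of \<tau>\<^sub>1]
      by eventually_elim (use bound in \<open>simp add: pos_le_divide_eq mult.commute\<close>)
    have "filterlim (\<lambda>\<tau>. - \<tau>\<^sub>1 + \<tau>) at_top at_top"
      by (intro filterlim_tendsto_add_at_top[OF tendsto_const] filterlim_ident)
    then show "((\<lambda>\<tau>. C / (\<tau> - \<tau>\<^sub>1)) \<longlongrightarrow> 0) at_top"
      by (intro real_tendsto_divide_at_top[OF tendsto_const]) simp
  qed (simp_all add: \<sigma>_nonneg)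
  then have "((\<lambda>\<tau>. inverse q * \<sigma> (u \<tau>) (u \<tau>)) \<longlongrightarrow> inverse q * 0) at_top"
    by (rule tendsto_mult_left)
  then show ?thesis
    using \<open>q > 0\<close> by (simp add: \<sigma>_def power2_eq_square flip: mult.assoc)
qed

end

section \<open>From jump degrees of freedom to an arbitrary norm\<close>

lemma is_norm_on_sum_le:
  assumes "is_norm_on (fe_space k \<Omega> \<T>) N" "finite J" "\<And>j. j \<in> J \<Longrightarrow> b j \<in> fe_space k \<Omega> \<T>"
  shows "N (\<lambda>x. \<Sum>j\<in>J. a j * b j x) \<le> (\<Sum>j\<in>J. \<bar>a j\<bar> * N (b j))"
  using assms(2,3)
proof induction
  case empty
  have "N (\<lambda>x. 0) = 0"
    using assms(1) zero_in_fe_space unfolding is_norm_on_def by blast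
  then show ?case by simp
next
  case (insert j J)
  have triangle: "N (\<lambda>x. v x + w x) \<le> N v + N w" if "v \<in> fe_space k \<Omega> \<T>" "w \<in> fe_space k \<Omega> \<T>" for v w
    using assms(1) that unfolding is_norm_on_def by blast
  have "(\<lambda>x. a j * b j x) \<in> fe_space k \<Omega> \<T>" "(\<lambda>x. \<Sum>j\<in>J. a j * b j x) \<in> fe_space k \<Omega> \<T>"
    using insert.prems by (auto intro: fe_space_scale fe_space_sum)
  then have "N (\<lambda>x. a j * b j x + (\<Sum>j\<in>J. a j * b j x)) \<le> N (\<lambda>x. a j * b j x) + N (\<lambda>x. \<Sum>j\<in>J. a j * b j x)"
    by (rule triangle)
  moreover have "N (\<lambda>x. a j * b j x) = \<bar>a j\<bar> * N (b j)"
    using assms(1) insert.prems unfolding is_norm_on_def by simp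
  ultimately show ?case
    using insert by simp
qed

text \<open>The triangle inequality bounds any norm of the error by a finite sum of jump degrees of
  freedom with weights \<open>N (\<phi> i)\<close> that do not depend on
  \<open>\<tau>\<close>.\<close>

lemma (in cut_fe) ext_op_error_tendsto_zero:
  fixes u :: "real \<Rightarrow> real ^ 'n \<Rightarrow> real"
  assumes u: "eventually (\<lambda>\<tau>. u \<tau> \<in> V) F"
    and lim: "((\<lambda>\<tau>. \<Sum>i\<in>I\<^sub>S. (jump_dof i (u \<tau>))\<^sup>2) \<longlongrightarrow> 0) F"
  shows "tends_to_zero_in V (\<lambda>\<tau> x. u \<tau> x - ext_op k \<gamma> \<Omega> \<T> \<phi> S t (u \<tau>) x) F"
  unfolding tends_to_zero_in_def
proof (intro allI impI)
  fix N assume N: "is_norm_on V N"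
  have IS: "I\<^sub>S \<subseteq> \<N>" by (auto simp: small_nodes_def)
  then have fin: "finite I\<^sub>S" using finite_nodes by (rule finite_subset)
  have b: "\<phi> i \<in> V" if "i \<in> I\<^sub>S" for i using basis_in_V that IS by blast
  let ?w = "\<lambda>\<tau> x. u \<tau> x - ext_op k \<gamma> \<Omega> \<T> \<phi> S t (u \<tau>) x"
  have w: "?w \<tau> = (\<lambda>x. \<Sum>i\<in>I\<^sub>S. jump_dof i (u \<tau>) * \<phi> i x)" if "u \<tau> \<in> V" for \<tau>
    using ext_op_error[OF that] by (rule ext)
  have jump: "((\<lambda>\<tau>. \<bar>jump_dof i (u \<tau>)\<bar>) \<longlongrightarrow> 0) F" if "i \<in> I\<^sub>S" for i
  proof -
    have "((\<lambda>\<tau>. (jump_dof i (u \<tau>))\<^sup>2) \<longlongrightarrow> 0) F"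
    proof (rule tendsto_sandwich[OF _ _ tendsto_const lim])
      show "\<forall>\<^sub>F \<tau> in F. (jump_dof i (u \<tau>))\<^sup>2 \<le> (\<Sum>i\<in>I\<^sub>S. (jump_dof i (u \<tau>))\<^sup>2)"
        using fin that by (intro always_eventually allI member_le_sum) auto
    qed simp
    then have "((\<lambda>\<tau>. sqrt ((jump_dof i (u \<tau>))\<^sup>2)) \<longlongrightarrow> sqrt 0) F"
      by (rule tendsto_real_sqrt)
    then show ?thesis by simp
  qed
  have "((\<lambda>\<tau>. \<Sum>i\<in>I\<^sub>S. \<bar>jump_dof i (u \<tau>)\<bar> * N (\<phi> i)) \<longlongrightarrow> (\<Sum>i\<in>I\<^sub>S. 0 * N (\<phi> i))) F"
    by (intro tendsto_sum tendsto_mult jump tendsto_const)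
  then have bound: "((\<lambda>\<tau>. \<Sum>i\<in>I\<^sub>S. \<bar>jump_dof i (u \<tau>)\<bar> * N (\<phi> i)) \<longlongrightarrow> 0) F" by simp
  show "((\<lambda>\<tau>. N (?w \<tau>)) \<longlongrightarrow> 0) F"
  proof (rule tendsto_sandwich[OF _ _ tendsto_const bound])
    show "\<forall>\<^sub>F \<tau> in F. 0 \<le> N (?w \<tau>)"
      using u
    proof eventually_elim
      case (elim \<tau>)
      \<comment> \<open>\<open>is_norm_on\<close> gives nonnegativity for members of
        \<open>V\<close> only.\<close>
      have "?w \<tau> \<in> V" unfolding w[OF elim] using b by (rule fe_space_sum)
      then show ?case using N unfolding is_norm_on_def by blast
    qed
    show "\<forall>\<^sub>F \<tau> in F. N (?w \<tau>) \<le> (\<Sum>i\<in>I\<^sub>S. \<bar>jump_dof i (u \<tau>)\<bar> * N (\<phi> i))"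
      using u by eventually_elim (simp only: w is_norm_on_sum_le[OF N fin b])
  qed
qed

theorem proposition3p2:
  fixes C\<^sub>I \<tau>\<^sub>s :: real
  assumes "C\<^sub>I > 0" and "\<tau>\<^sub>s > 0"
  shows "\<exists>\<beta>\<^sub>0>0. \<exists>c\<^sub>0>0.
    \<forall>(k::nat) (\<gamma>::real) (h\<^sub>0::real) (\<Omega>\<^sub>0 :: (real ^ 'n) set) (\<Omega> :: (real ^ 'n) set)
      (n :: real ^ 'n \<Rightarrow> real ^ 'n)
      (\<T> :: real \<Rightarrow> (real ^ 'n) set set)
      (\<phi> :: real \<Rightarrow> real ^ 'n \<Rightarrow> real ^ 'n \<Rightarrow> real)
      (S :: real \<Rightarrow> (real ^ 'n) set \<Rightarrow> (real ^ 'n) set)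
      (t :: real \<Rightarrow> real ^ 'n \<Rightarrow> (real ^ 'n) set)
      (f :: real ^ 'n \<Rightarrow> real) (\<beta>::real) (\<tau>\<^sub>0::real).
      k \<ge> 1 \<and> 0 < \<gamma> \<and> \<gamma> \<le> 1 \<and> h\<^sub>0 > 0 \<and>
      closed_domain \<Omega>\<^sub>0 \<and> quasiuniform_family \<Omega>\<^sub>0 h\<^sub>0 \<T> \<and>
      closed_domain \<Omega> \<and> \<Omega> \<subseteq> \<Omega>\<^sub>0 \<and> regular_boundary \<Omega> n \<and>
      (\<forall>h\<in>{0<..h\<^sub>0}.
         nodal_basis k \<Omega> (\<T> h) (\<phi> h) \<and>
         S h \<in> small_elems \<gamma> \<Omega> (\<T> h) \<rightarrow> large_elems \<gamma> \<Omega> (\<T> h) \<and>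
         element_choice k \<gamma> \<Omega> (\<T> h) (\<phi> h) (t h)) \<and>
      inverse_inequality k \<gamma> \<Omega> n h\<^sub>0 \<T> \<phi> S t C\<^sub>I \<tau>\<^sub>s \<and>
      f \<in> L2_functions lebesgue \<Omega> \<and>
      \<beta> \<ge> \<beta>\<^sub>0 \<and> \<tau>\<^sub>0 \<ge> c\<^sub>0 * inverse \<beta>
      \<longrightarrow>
      (\<forall>h\<in>{0<..h\<^sub>0}. \<forall>u :: real \<Rightarrow> real ^ 'n \<Rightarrow> real.
         (\<forall>\<tau>\<ge>\<tau>\<^sub>0. discrete_solution k \<gamma> \<Omega> n (\<T> h) (\<phi> h) (S h) (t h) \<beta> h \<tau> f (u \<tau>)) \<longrightarrow>
         tends_to_zero_in (fe_space k \<Omega> (\<T> h))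
           (\<lambda>\<tau>. \<lambda>x. u \<tau> x - ext_op k \<gamma> \<Omega> (\<T> h) (\<phi> h) (S h) (t h) (u \<tau>) x) at_top)"
\<comment> \<open>The witness for \<open>\<beta>\<^sub>0\<close> is the threshold of
  \<open>form_nonneg\<close>. Case 3 is the implication; the cases before it are the positivity of
  the two constants.\<close>
proof (intro exI[of _ C\<^sub>I] conjI exI[of _ "1::real"] allI impI ballI, goal_cases)
  case (3 k \<gamma> h\<^sub>0 \<Omega>\<^sub>0 \<Omega> n \<T> \<phi> S t f \<beta> \<tau>\<^sub>0 h u)
  then have h: "h \<in> {0<..h\<^sub>0}" "h > 0" by auto
  have domain: "closed_domain \<Omega>" and mesh: "simplicial_mesh \<Omega>\<^sub>0 (\<T> h)" and "\<beta> \<ge> C\<^sub>I"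
    using 3 by (auto simp: quasiuniform_family_def)
  obtain c where c: "c > 0" "\<forall>T\<in>\<T> h. \<exists>x. cball x (c * h) \<subseteq> T"
    using 3 h(1) unfolding quasiuniform_family_def by meson
  have inverse: "h * (l2_norm surface_measure (frontier \<Omega>) (normal_deriv n v))\<^sup>2
      \<le> C\<^sub>I * ((l2_norm lebesgue \<Omega> (grad v))\<^sup>2 + s_form k \<gamma> \<Omega> (\<T> h) (\<phi> h) (S h) (t h) h \<tau>\<^sub>s v v)"
    if "v \<in> fe_space k \<Omega> (\<T> h)" for v
    using 3 h(1) that unfolding inverse_inequality_def by blast
  have sol: "discrete_solution k \<gamma> \<Omega> n (\<T> h) (\<phi> h) (S h) (t h) \<beta> h \<tau> f (u \<tau>)" if "\<tau> \<ge> \<tau>\<^sub>0" for \<tau>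
    using 3(3) that by simp
  interpret cut_method k \<Omega> "\<T> h" "\<phi> h" \<gamma> "S h" "t h" n
  proof unfold_locales
    show "interior T \<noteq> {}" if T: "T \<in> \<T> h" for T
    proof -
      obtain x where "cball x (c * h) \<subseteq> T" using c(2) T by blast
      then have "ball x (c * h) \<subseteq> interior T"
        using ball_subset_cball by (intro interior_maximal) auto
      moreover have "x \<in> ball x (c * h)" using c(1) h(2) by simp
      ultimately show ?thesis by blast
    qed
    show "closed \<Omega>" using domain closed_closure unfolding closed_domain_def by metis
  qed (use 3 h(1) mesh in \<open>auto simp: simplicial_mesh_def triangulation_def\<close>)
  show ?case
  proof (rule ext_op_error_tendsto_zero)
    show "\<forall>\<^sub>F \<tau> in at_top. u \<tau> \<in> fe_space k \<Omega> (\<T> h)"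
      using eventually_ge_at_top[of \<tau>\<^sub>0]
      by eventually_elim (use sol in \<open>simp add: discrete_solution_def\<close>)
    show "((\<lambda>\<tau>. \<Sum>i\<in>small_nodes k \<gamma> \<Omega> (\<T> h) (\<phi> h). (jump_dof i (u \<tau>))\<^sup>2) \<longlongrightarrow> 0) at_top"
    proof (rule stabilization_tendsto_zero[OF h(2) _ sol])
      show "0 \<le> a_form \<Omega> n \<beta> h v v + s_form k \<gamma> \<Omega> (\<T> h) (\<phi> h) (S h) (t h) h \<tau>\<^sub>s v v"
        if "v \<in> fe_space k \<Omega> (\<T> h)" for v
        using form_nonneg[OF that h(2) assms(1) \<open>\<beta> \<ge> C\<^sub>I\<close> inverse[OF that]] .
    qed
  qed
qed (use assms in auto)

end
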